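(* For integers $\alpha,\beta,\gamma,\delta$ and $n\ge 1$ let $$F_{\alpha,\beta,\gamma,\delta}(n):=\det_{0\leq i,j\le n-1}\left(4^{i+\beta}\binom{i+2j+\gamma}{2j+\alpha}+\binom{-i+2j+\delta}{2j+\alpha}\right).$$ The following determinant evaluations hold for all $n\geq1$: \begin{align*} F_{1, 0, 1, 1}(n) &= 2\prod_{i=1}^{n} \frac{3^{i-1}\,\Gamma(3i-1)\,\Gamma\bigl(\frac{i+1}{2}\bigr)}{\Gamma(2i)\,\Gamma\bigl(\frac{3i-1}{2}\bigr)},\\ F_{1, 0, 2, 2}(n) &= 2\prod_{i=1}^{n} \frac{3^{i-1}\,\Gamma(3i)\,\Gamma\bigl(\frac{i}{2}\bigr)}{2\,\Gamma(2i)\,\Gamma\bigl(\frac{3i}{2}\bigr)},\\ F_{1, 0, 3, 3}(n) &= 2\prod_{i=1}^{n} \frac{3^i\,\Gamma(3i-1)\,\Gamma\bigl(\frac{i+1}{2}\bigr)}{\Gamma(2i)\,\Gamma\bigl(\frac{3i-1}{2}\bigr)}. \end{align*} Moreover, the following identities hold for all $n\geq4$: \begin{align*} F_{1, 0, 1, 1}(n) &= \tfrac23 \, F_{1, 1, -1, -3}(n) = \tfrac{1}{21} \, F_{1, 2, -3, -7}(n),\\ F_{1, 0, 2, 2}(n) &= -2 \, F_{1, 1, 0, -2}(n) = \tfrac27 \, F_{1, 2, -2, -6}(n),\\ F_{1, 0, 3, 3}(n) &= 2 \, F_{1, 1, 1, -1}(n) = \tfrac25 \, F_{1, 2, -1,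 -5}(n) =\tfrac{1}{99} \, F_{1, 3, -3, -9}(n),\\ F_{1, 1, -1, -3}(n) &= -6 \, F_{3, 2, 2, -2}(n-1) = 24 \, F_{5, 3, 5, -1}(n-2),\\ F_{1, 1, 0, -2}(n) &= -2 \, F_{3, 2, 3, -1}(n-1). \end{align*}
   Context: For an integer $m$ (possibly negative) and an integer $p\ge 0$, $\binom{m}{p}=\frac{m(m-1)\cdots(m-p+1)}{p!}$; for $p<0$, $\binom{m}{p}=0$. *)

theory Defs
  imports "HOL-Analysis.Gamma_Function" "Jordan_Normal_Form.Determinant"
begin

text \<open>
  The library's \<open>gchoose\<close> already is m(m-1)...(m-p+1)/p! for arbitrary m, but only takes a lower
  index of type \<^typ>\<open>nat\<close>; the convention for negative p has to be added.
\<close>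

definition int_binom :: "int \<Rightarrow> int \<Rightarrow> real" where
  "int_binom m p = (if p < 0 then 0 else of_int m gchoose nat p)"

definition F :: "int \<Rightarrow> int \<Rightarrow> int \<Rightarrow> int \<Rightarrow> nat \<Rightarrow> real" where
  "F \<alpha> \<beta> \<gamma> \<delta> n = det (mat n n (\<lambda>(i, j).
     4 powi (int i + \<beta>) * int_binom (int i + 2 * int j + \<gamma>) (2 * int j + \<alpha>)
     + int_binom (- int i + 2 * int j + \<delta>) (2 * int j + \<alpha>)))"

end

theory Submission
  imports Defs "HOL-Computational_Algebra.Polynomial_FPS"
begin

text \<open>
  Let \<open>e\<close> be \<open>\<alpha> - 1 - (\<gamma> + \<delta>) / 2\<close> and \<open>I = i + \<beta>\<close>. In all the families \<open>2 \<beta> = \<gamma> - \<delta>\<close>, so the entries of row \<open>i\<close> are, up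
  to sign, the coefficients at \<open>\<alpha>, \<alpha> + 2, \<dots>\<close> of \<open>4^I (1 + x)^(e - I) + (1 + x)^(e + I)\<close>. By cofactor expansion,
  two consecutive determinants have ratio \<open>c\<close> if every combination of these series whose odd part vanishes up to
  order \<open>2 k + 1\<close> satisfies one linear relation, with factor \<open>c\<close>, between its top coefficient and its coefficient at
  \<open>2 k + 1\<close>.

  With \<open>u = (1 + x) / 2\<close> the row is a multiple of \<open>u^e (u^I + u^-I)\<close>: the symmetry \<open>u \<mapsto> 1 / u\<close> together with
  \<open>x \<mapsto> -x\<close>, that is \<open>u \<mapsto> 1 - u\<close>, generates a group isomorphic to \<open>S_3\<close>. The Moebius coordinate \<open>w\<close> with
  \<open>x = i sqrt 3 (w - 1) / (w + 1)\<close> turns its elements of order 3 into \<open>w \<mapsto> \<omega> w\<close>. After clearing denominators the odd part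
  becomes a polynomial \<open>g\<close> in \<open>w\<close> in which the exponents of one residue class mod 3 do not occur. Only
  \<open>2 k + 2\<close> exponents remain and \<open>g\<close> vanishes to order \<open>2 k + 1\<close> at 1, so the coefficients of \<open>g\<close> are those of a divided
  difference. The top coefficient of the combination is read off from the value of \<open>g\<close> at the sixth root of unity
  corresponding to \<open>u = 0\<close>, and that value is a terminating well-poised series at -1, which Kummer's theorem sums.
  The ratio depends only on \<open>k\<close> and on \<open>e\<close> mod 3; hence all families with the same residue are proportional
  as soon as the argument applies, and one value for each family fixes the factor.
\<close>

section \<open>Determinants, sparse polynomials and Kummer summation\<close>

text \<open>The hypothesis is applied to the cofactors of the last column of \<open>B\<close>: they
  annihilate all earlier columns, give \<open>det B\<close> in column \<open>k\<close>, and the last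
  of them is the smaller determinant.\<close>

lemma det_Suc_ratio:
  fixes M :: "nat \<Rightarrow> nat \<Rightarrow> 'a::field"
  assumes "\<And>a. (\<And>j. j < k \<Longrightarrow> (\<Sum>i\<le>k. a i * M i j) = 0) \<Longrightarrow> (\<Sum>i\<le>k. a i * M i k) = c * a k"
  shows "det (mat (Suc k) (Suc k) (\<lambda>(i, j). M i j)) = c * det (mat k k (\<lambda>(i, j). M i j))"
proof -
  define B where "B = mat (Suc k) (Suc k) (\<lambda>(i, j). M i j)"
  have B: "B \<in> carrier_mat (Suc k) (Suc k)"
    by (simp add: B_def)
  define a where "a i = cofactor B i k" for i
  have eq: "(\<Sum>i\<le>k. a i * M i j) = (if j = k then det B else 0)" if "j \<le> k" for j
  proof -
    have "(adj_mat B * B) $$ (k, j) = (\<Sum>i\<le>k. a i * M i j)"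
      using that B by (simp add: adj_mat_def scalar_prod_def B_def a_def atLeast0LessThan lessThan_Suc_atMost)
    moreover have "(adj_mat B * B) $$ (k, j) = (if j = k then det B else 0)"
      using that adj_mat(3)[OF B] by auto
    ultimately show ?thesis by simp
  qed
  have "mat_delete B k k = mat k k (\<lambda>(i, j). M i j)"
    by (rule eq_matI) (auto simp: mat_delete_def B_def)
  moreover have "det B = c * a k"
    using assms[of a] eq by simp
  ultimately show ?thesis
    by (simp add: a_def cofactor_def flip: B_def mult_2)
qed

section \<open>Sparse polynomials with a zero of high order at 1\<close>

definition theta_shift :: "nat \<Rightarrow> 'a::field_char_0 poly \<Rightarrow> 'a poly" where
  "theta_shift m p = [:0, 1:] * pderiv p - smult (of_nat m) p"

lemma coeff_theta_shift: "coeff (theta_shift m p) j = (of_nat j - of_nat m) * coeff p j"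
  by (cases j) (auto simp: theta_shift_def coeff_pderiv coeff_pCons algebra_simps)

text \<open>The Euler operator lowers the order of the zero at 1 by one; at 1 only the term from
  differentiating the power survives, whence the factor \<open>Suc N\<close>.\<close>

lemma theta_shift_vanishing:
  fixes R :: "'a::field_char_0 poly"
  shows "\<exists>R'. theta_shift m ([:-1, 1:] ^ Suc N * R) = [:-1, 1:] ^ N * R' \<and> poly R' 1 = of_nat (Suc N) * poly R 1"
proof (intro exI conjI)
  let ?R' = "[:0, 1:] * (smult (of_nat (Suc N)) R + [:-1, 1:] * pderiv R) - smult (of_nat m) ([:-1, 1:] * R)"
  have "pderiv ([:-1, 1:] ^ Suc N * R) = [:-1, 1:] ^ N * (smult (of_nat (Suc N)) R + [:-1, 1:] * pderiv R)"
    unfolding pderiv_mult pderiv_power_Suc by (simp add: pderiv_pCons algebra_simps)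
  then show "theta_shift m ([:-1, 1:] ^ Suc N * R) = [:-1, 1:] ^ N * ?R'"
    unfolding theta_shift_def by (simp only: power_Suc) (simp add: algebra_simps)
  show "poly ?R' 1 = of_nat (Suc N) * poly R 1"
    by simp
qed

lemma iterated_theta_shift:
  fixes R :: "'a::field_char_0 poly"
  assumes "finite S"
  shows "\<exists>q. (\<forall>j. coeff q j = (\<Prod>m\<in>S. of_nat j - of_nat m) * coeff ([:-1, 1:] ^ card S * R) j)
           \<and> poly q 1 = fact (card S) * poly R 1"
  using assms
proof (induction S arbitrary: R rule: finite_induct)
  case empty
  then show ?case by auto
next
  case (insert m S)
  obtain R' where R': "theta_shift m ([:-1, 1:] ^ Suc (card S) * R) = [:-1, 1:] ^ card S * R'"
      "poly R' 1 = of_nat (Suc (card S)) * poly R 1"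
    using theta_shift_vanishing by blast
  obtain q where q: "\<And>j. coeff q j = (\<Prod>m\<in>S. of_nat j - of_nat m) * coeff ([:-1, 1:] ^ card S * R') j"
      "poly q 1 = fact (card S) * poly R' 1"
    using insert.IH by blast
  have "coeff q j = (\<Prod>m\<in>insert m S. of_nat j - of_nat m) * coeff ([:-1, 1:] ^ card (insert m S) * R) j" for j
    unfolding q(1) R'(1)[symmetric] coeff_theta_shift using insert.hyps by simp
  moreover have "poly q 1 = fact (card (insert m S)) * poly R 1"
    using insert.hyps q(2) R'(2) by (simp add: algebra_simps)
  ultimately show ?case by blast
qed

text \<open>Removing each exponent of \<open>E\<close> except \<open>m\<close> by one shift uses up
  exactly the \<open>N\<close> orders of vanishing. A monomial is left, whose value at 1 is its
  coefficient.\<close>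

lemma sparse_poly_coeff:
  fixes R :: "'a::field_char_0 poly"
  assumes "finite E" "card E = Suc N" "m \<in> E"
    and p: "p = [:-1, 1:] ^ N * R" "\<And>j. j \<notin> E \<Longrightarrow> coeff p j = 0"
  shows "coeff p m = fact N * poly R 1 / (\<Prod>m'\<in>E - {m}. of_nat m - of_nat m')"
proof -
  have "card (E - {m}) = N" using assms by simp
  then obtain q where q: "\<And>j. coeff q j = (\<Prod>m'\<in>E - {m}. of_nat j - of_nat m') * coeff p j"
      "poly q 1 = fact N * poly R 1"
    using iterated_theta_shift[of "E - {m}" R] assms by auto
  have "coeff q j = 0" if "j \<noteq> m" for j
    using that \<open>finite E\<close> p(2) by (cases "j \<in> E") (auto simp: q(1) intro!: prod_zero)
  then have "q = monom (coeff q m) m"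
    by (intro poly_eqI) auto
  then have "poly q 1 = coeff q m"
    by (metis poly_monom power_one mult.right_neutral)
  moreover have "(\<Prod>m'\<in>E - {m}. of_nat m - of_nat m' :: 'a) \<noteq> 0"
    using \<open>finite E\<close> by auto
  ultimately show ?thesis using q by (simp add: field_simps)
qed

lemma sparse_poly_eval:
  fixes R :: "'a::field_char_0 poly"
  assumes "finite E" "card E = Suc N"
    and p: "p = [:-1, 1:] ^ N * R" "\<And>j. j \<notin> E \<Longrightarrow> coeff p j = 0"
  shows "poly p z = fact N * poly R 1 * (\<Sum>m\<in>E. z ^ m / (\<Prod>m'\<in>E - {m}. of_nat m - of_nat m'))"
proof -
  have "poly p z = (\<Sum>m\<in>E \<union> {..degree p}. coeff p m * z ^ m)"
    unfolding poly_altdef using assms by (intro sum.mono_neutral_left) (auto simp: coeff_eq_0)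
  also have "\<dots> = (\<Sum>m\<in>E. coeff p m * z ^ m)"
    using assms by (intro sum.mono_neutral_right) auto
  also have "\<dots> = (\<Sum>m\<in>E. fact N * poly R 1 * (z ^ m / (\<Prod>m'\<in>E - {m}. of_nat m - of_nat m')))"
    using sparse_poly_coeff[OF assms(1,2) _ p] by (intro sum.cong) auto
  finally show ?thesis by (simp add: sum_distrib_left)
qed

section \<open>Kummer's terminating sum\<close>

lemma alternating_middle_sum_eq_0:
  fixes n k :: nat
  assumes "odd n" "n \<le> 2 * k"
  shows "(\<Sum>a\<le>k. (-1) ^ a * (of_nat n gchoose a) * (of_nat (2 * k - n) gchoose (k - a))) = (0 :: 'a::field_char_0)"
proof -
  define g :: "nat \<Rightarrow> 'a" where "g a = (-1) ^ a * of_nat (n choose a) * of_nat ((2 * k - n) choose (k - a))" for a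
  \<comment> \<open>Inside \<open>A\<close> the reflection from \<open>a\<close> to
    \<open>n - a\<close> involves no truncated subtraction, and it flips the sign because
    \<open>n\<close> is odd. Outside \<open>A\<close> one of the two binomials is zero.\<close>
  define A where "A = {a. a \<le> k \<and> a \<le> n \<and> n \<le> a + k}"
  have gr: "g (n - a) = - g a" if "a \<in> A" for a
  proof -
    have *: "a \<le> k" "a \<le> n" "n \<le> a + k" using that by (auto simp: A_def)
    have "(n choose (n - a)) = (n choose a)" using * by (simp add: binomial_symmetric[symmetric])
    moreover have "((2 * k - n) choose (k - (n - a))) = ((2 * k - n) choose (k - a))"
      using * assms by (subst binomial_symmetric) auto
    moreover have "(-1) ^ (n - a) = (- ((-1) ^ a) :: 'a)"
      using * \<open>odd n\<close> by (cases "even a") auto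
    ultimately show ?thesis by (simp add: g_def)
  qed
  have "(\<Sum>a\<in>A. g a) = (\<Sum>a\<in>A. g (n - a))"
    by (rule sum.reindex_bij_witness[of _ "\<lambda>a. n - a" "\<lambda>a. n - a"]) (auto simp: A_def)
  also have "\<dots> = - (\<Sum>a\<in>A. g a)" by (simp add: gr sum_negf)
  finally have "(\<Sum>a\<in>A. g a) = 0" by (simp add: eq_neg_iff_add_eq_0 flip: mult_2)
  moreover have "(\<Sum>a\<le>k. g a) = (\<Sum>a\<in>A. g a)"
    using assms(2) by (intro sum.mono_neutral_right) (auto simp: A_def g_def)
  ultimately show ?thesis by (simp add: g_def binomial_gbinomial)
qed

text \<open>A binomial whose upper index is affine in a variable, as a polynomial, so that degree
  counts can prove identities in a field parameter.\<close>

definition gchoose_poly :: "'a::field_char_0 \<Rightarrow> 'a \<Rightarrow> nat \<Rightarrow> 'a poly" where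
  "gchoose_poly c s a = smult (1 / fact a) (\<Prod>i = 0..<a. [:c - of_nat i, s:])"

lemma poly_gchoose_poly: "poly (gchoose_poly c s a) x = (c + s * x) gchoose a"
  by (simp add: gchoose_poly_def gbinomial_prod_rev poly_prod algebra_simps)

lemma degree_gchoose_poly: "degree (gchoose_poly c s a) \<le> a"
proof -
  have "degree (\<Prod>i = 0..<a. [:c - of_nat i, s:]) \<le> (\<Sum>i = 0..<a. 1)"
    by (rule order_trans[OF degree_prod_sum_le]) (auto intro!: sum_mono)
  then show ?thesis by (simp add: gchoose_poly_def)
qed

lemma prod_odd_numbers: "(\<Prod>l<k. 2 * of_nat l + 1) * (2 ^ k * fact k) = (fact (2 * k) :: 'a::field_char_0)"
proof (induction k)
  case (Suc k)
  have "(\<Prod>l<Suc k. 2 * of_nat l + 1) * (2 ^ Suc k * fact (Suc k)) =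
        of_nat (2 * k + 2) * (of_nat (2 * k + 1) * ((\<Prod>l<k. 2 * of_nat l + 1) * (2 ^ k * fact k) :: 'a))"
    by (simp add: algebra_simps)
  also have "\<dots> = of_nat (2 * k + 2) * (of_nat (2 * k + 1) * fact (2 * k))"
    by (simp only: Suc.IH)
  also have "\<dots> = fact (2 * Suc k)" by (simp only: mult_Suc_right add_2_eq_Suc fact_Suc) (simp add: mult.assoc)
  finally show ?case .
qed simp

text \<open>
  Both sides are polynomials in \<open>d\<close>; at \<open>d = k - 1 - 2 l\<close> the left-hand side is the middle coefficient of an
  anti-palindromic polynomial.
\<close>

lemma terminating_Kummer:
  fixes d :: "'a::field_char_0"
  shows "(\<Sum>a\<le>k. (-1) ^ a * ((of_nat k + d) gchoose a) * ((of_nat k - d) gchoose (k - a)))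
         = (-2) ^ k / fact k * (\<Prod>l<k. d - (of_nat k - 1 - 2 * of_nat l))"
proof -
  define P where "P = gchoose_poly (of_nat k) (1 :: 'a)"
  define Q where "Q = gchoose_poly (of_nat k) (-1 :: 'a)"
  have P: "poly (P a) x = (of_nat k + x) gchoose a" "degree (P a) \<le> a" for a x
    by (simp_all add: P_def poly_gchoose_poly degree_gchoose_poly)
  have Q: "poly (Q a) x = (of_nat k - x) gchoose a" "degree (Q a) \<le> a" for a x
    by (simp_all add: Q_def poly_gchoose_poly degree_gchoose_poly)
  define r :: "nat \<Rightarrow> 'a" where "r l = of_nat k - 1 - 2 * of_nat l" for l
  define S where "S = (\<Sum>a\<le>k. smult ((-1) ^ a) (P a * Q (k - a)))"
  define T where "T = smult ((-2) ^ k / fact k) (\<Prod>l<k. [:- r l, 1:])"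
  \<comment> \<open>Test points for two polynomials of degree at most \<open>k\<close>: the
    \<open>k\<close> roots of \<open>T\<close>, and \<open>of_nat k\<close>, where only the summand
    \<open>a = k\<close> survives.\<close>
  define Z where "Z = insert (of_nat k) (r ` {..<k})"
  have polyS: "poly S x = (\<Sum>a\<le>k. (-1) ^ a * ((of_nat k + x) gchoose a) * ((of_nat k - x) gchoose (k - a)))" for x
    by (simp add: S_def poly_sum P Q mult.assoc)
  have polyT: "poly T x = (-2) ^ k / fact k * (\<Prod>l<k. x - r l)" for x
    by (simp add: T_def poly_prod)
  have "inj_on r {..<k}" by (auto simp: inj_on_def r_def)
  moreover have "of_nat k \<noteq> r l" for l
  proof
    assume "of_nat k = r l"
    then have "of_nat (2 * l + 1) = (0 :: 'a)" by (simp add: r_def algebra_simps)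
    then show False by (simp only: of_nat_eq_0_iff)
  qed
  ultimately have cardZ: "card Z = Suc k" by (auto simp: Z_def card_insert_if card_image)
  have "degree (P a * Q (k - a)) \<le> k" if "a \<le> k" for a
    using degree_mult_le[of "P a" "Q (k - a)"] P(2)[of a] Q(2)[of "k - a"] that by linarith
  then have degS: "degree S \<le> k"
    unfolding S_def by (intro degree_sum_le) (auto intro: order_trans[OF degree_smult_le])
  have "degree (\<Prod>l<k. [:- r l, 1:]) \<le> (\<Sum>l<k. 1)"
    by (rule order_trans[OF degree_prod_sum_le]) (auto intro!: sum_mono)
  then have degT: "degree T \<le> k" unfolding T_def by (simp add: order_trans[OF degree_smult_le])
  have "S = T"
  proof (rule poly_eqI_degree)
    fix x assume "x \<in> Z"
    then consider "x = of_nat k" | l where "x = r l" "l < k" by (auto simp: Z_def)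
    then show "poly S x = poly T x"
    proof cases
      case 1
      have "poly S x = (\<Sum>a\<in>{k}. (-1) ^ a * ((of_nat k + x) gchoose a) * ((of_nat k - x) gchoose (k - a)))"
        unfolding polyS
      proof (rule sum.mono_neutral_right)
        show "\<forall>a\<in>{..k} - {k}. (-1) ^ a * ((of_nat k + x) gchoose a) * ((of_nat k - x) gchoose (k - a)) = 0"
        proof
          fix a assume "a \<in> {..k} - {k}"
          then have "(of_nat k - x) gchoose (k - a) = 0"
            by (auto simp: 1 gbinomial_0_left)
          then show "(-1) ^ a * ((of_nat k + x) gchoose a) * ((of_nat k - x) gchoose (k - a)) = 0"
            by (simp only: mult_zero_right)
        qed
      qed auto
      also have "\<dots> = (-1) ^ k * of_nat ((2 * k) choose k)"
        by (simp add: 1 binomial_gbinomial)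
      also have "\<dots> = (-1) ^ k * (fact (2 * k) / (fact k * fact k))"
        by (simp add: binomial_fact)
      also have "\<dots> = (-2) ^ k / fact k * (\<Prod>l<k. 2 * of_nat l + 1)"
        unfolding prod_odd_numbers[symmetric] by (simp add: field_simps flip: power_mult_distrib)
      also have "(\<Prod>l<k. 2 * of_nat l + 1) = (\<Prod>l<k. x - r l)"
        by (intro prod.cong) (auto simp: 1 r_def)
      finally show ?thesis by (simp add: polyT)
    next
      case 2
      define n where "n = 2 * k - 1 - 2 * l"
      have n: "odd n" "n \<le> 2 * k" using \<open>l < k\<close> by (auto simp: n_def)
      have n1: "n + (2 * l + 1) = 2 * k" using \<open>l < k\<close> by (auto simp: n_def)
      then have "of_nat n + (2 * of_nat l + 1) = (2 * of_nat k :: 'a)"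
        by (metis of_nat_add of_nat_mult of_nat_numeral of_nat_1)
      then have "of_nat k + x = of_nat n"
        unfolding 2 r_def by (simp add: algebra_simps)
      moreover from n1 have "2 * k - n = 2 * l + 1" by simp
      then have "of_nat (2 * k - n) = (2 * of_nat l + 1 :: 'a)" by simp
      then have "of_nat k - x = of_nat (2 * k - n)"
        unfolding 2 r_def by simp
      ultimately have "poly S x = 0"
        unfolding polyS by (simp only: alternating_middle_sum_eq_0[OF n])
      moreover have "poly T x = 0"
        unfolding polyT using 2 by (auto intro!: prod_zero)
      ultimately show ?thesis by simp
    qed
  qed (use degS degT cardZ in auto)
  then show ?thesis using polyS[of d] polyT[of d] by (simp add: r_def)
qed

section \<open>The exponents that survive\<close>

text \<open>For \<open>d\<close> equal to 1 or 2 these are \<open>2 * k + 2\<close> exponents in two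
  residue classes mod 3; the third class stays empty.\<close>

definition nodes :: "nat \<Rightarrow> nat \<Rightarrow> nat \<Rightarrow> nat set" where
  "nodes c d k = (\<lambda>a. 3 * a + c) ` {..k} \<union> (\<lambda>a. 3 * a + c + d) ` {..k}"

lemma finite_nodes: "finite (nodes c d k)"
  by (simp add: nodes_def)

lemma nodes_disjoint:
  fixes a b c d :: nat
  assumes "d \<in> {1, 2}"
  shows "3 * a + c \<noteq> 3 * b + c + d"
proof
  assume "3 * a + c = 3 * b + c + d"
  then have "3 * a = 3 * b + d" by simp
  then have "(3 * a) mod 3 = (3 * b + d) mod 3" by simp
  then show False using assms by auto
qed

lemma sum_nodes:
  assumes "d \<in> {1, 2}"
  shows "(\<Sum>m\<in>nodes c d k. f m) = (\<Sum>a\<le>k. f (3 * a + c)) + (\<Sum>a\<le>k. f (3 * a + c + d))"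
  unfolding nodes_def using nodes_disjoint[OF assms]
  by (subst sum.union_disjoint) (auto simp: sum.reindex inj_on_def)

lemma card_nodes:
  assumes "d \<in> {1, 2}"
  shows "card (nodes c d k) = Suc (2 * k + 1)"
  using sum_nodes[OF assms, of "\<lambda>_. 1 :: nat" c k] by simp

lemma prod_differences:
  assumes "a \<le> k"
  shows "(\<Prod>b\<in>{..k} - {a}. of_nat a - of_nat b :: 'a::field_char_0) = (-1) ^ (k - a) * fact a * fact (k - a)"
proof -
  have up: "(\<Prod>b\<in>{a<..a + n}. of_nat a - of_nat b) = ((-1) ^ n * fact n :: 'a)" for n
  proof (induction n)
    case (Suc n)
    have "{a<..a + Suc n} = insert (a + Suc n) {a<..a + n}" by auto
    then show ?case using Suc by (simp add: algebra_simps)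
  qed simp
  have low: "(\<Prod>b<a. of_nat a - of_nat b) = (fact a :: 'a)"
    unfolding fact_prod_rev of_nat_prod by (auto simp: atLeast0LessThan intro!: prod.cong)
  have "{..k} - {a} = {..<a} \<union> {a<..a + (k - a)}" using assms by auto
  moreover have "(\<Prod>b\<in>{..<a} \<union> {a<..a + (k - a)}. of_nat a - of_nat b :: 'a) =
        (\<Prod>b<a. of_nat a - of_nat b) * (\<Prod>b\<in>{a<..a + (k - a)}. of_nat a - of_nat b)"
    by (rule prod.union_disjoint) auto
  ultimately have "(\<Prod>b\<in>{..k} - {a}. of_nat a - of_nat b :: 'a) = fact a * ((-1) ^ (k - a) * fact (k - a))"
    unfolding up low by metis
  then show ?thesis by (simp only: mult_ac)
qed

definition cross_prod :: "nat \<Rightarrow> nat \<Rightarrow> nat \<Rightarrow> 'a::field_char_0" where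
  "cross_prod d k a = (\<Prod>b\<le>k. 3 * (of_nat a - of_nat b) - of_nat d)"

text \<open>Up to sign, the value at \<open>a = 0\<close> of the product in
  \<open>cross_prod_binomials\<close>, which depends on \<open>a\<close> only through its
  sign.\<close>

definition cross_const :: "nat \<Rightarrow> nat \<Rightarrow> 'a::field_char_0" where
  "cross_const d k = (\<Prod>b\<le>k. 3 * of_nat b + of_nat d) * (\<Prod>j<k. of_nat k - of_nat d / 3 - of_nat j)"

lemma node_prod_lower:
  assumes "d \<in> {1, 2}" "a \<le> k"
  shows "(\<Prod>m'\<in>nodes c d k - {3 * a + c}. of_nat (3 * a + c) - of_nat m')
         = 3 ^ k * (-1) ^ (k - a) * fact a * fact (k - a) * (cross_prod d k a :: 'a::field_char_0)"
proof -
  have *: "nodes c d k - {3 * a + c} = (\<lambda>b. 3 * b + c) ` ({..k} - {a}) \<union> (\<lambda>b. 3 * b + c + d) ` {..k}"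
    unfolding nodes_def using nodes_disjoint[OF assms(1)] by auto
  have "(\<Prod>m'\<in>nodes c d k - {3 * a + c}. of_nat (3 * a + c) - of_nat m' :: 'a) =
      (\<Prod>b\<in>{..k} - {a}. 3 * (of_nat a - of_nat b)) * (\<Prod>b\<le>k. 3 * (of_nat a - of_nat b) - of_nat d)"
    unfolding * using nodes_disjoint[OF assms(1)]
    by (subst prod.union_disjoint) (auto simp: prod.reindex inj_on_def algebra_simps)
  also have "(\<Prod>b\<in>{..k} - {a}. 3 * (of_nat a - of_nat b) :: 'a) =
      3 ^ k * ((-1) ^ (k - a) * fact a * fact (k - a))"
    using assms(2) by (subst prod.distrib) (simp add: prod_differences[OF assms(2)])
  finally show ?thesis by (simp add: cross_prod_def algebra_simps)
qed

text \<open>Reflecting \<open>b\<close> to \<open>k - b\<close> turns the differences to the lower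
  class into minus those of the lower node with index \<open>k - a\<close>, so both classes share
  \<open>cross_prod\<close>.\<close>

lemma node_prod_upper:
  assumes "d \<in> {1, 2}" "a \<le> k"
  shows "(\<Prod>m'\<in>nodes c d k - {3 * a + c + d}. of_nat (3 * a + c + d) - of_nat m')
         = - (3 ^ k * (-1) ^ a * fact a * fact (k - a) * (cross_prod d k (k - a) :: 'a::field_char_0))"
proof -
  have *: "nodes c d k - {3 * a + c + d} = (\<lambda>b. 3 * b + c + d) ` ({..k} - {a}) \<union> (\<lambda>b. 3 * b + c) ` {..k}"
    unfolding nodes_def using nodes_disjoint[OF assms(1)] nodes_disjoint[OF assms(1), symmetric] by auto
  have "(\<Prod>m'\<in>nodes c d k - {3 * a + c + d}. of_nat (3 * a + c + d) - of_nat m' :: 'a) =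
      (\<Prod>b\<in>{..k} - {a}. 3 * (of_nat a - of_nat b)) * (\<Prod>b\<le>k. 3 * (of_nat a - of_nat b) + of_nat d)"
    unfolding * using nodes_disjoint[OF assms(1), symmetric]
    by (subst prod.union_disjoint) (auto simp: prod.reindex inj_on_def algebra_simps)
  also have "(\<Prod>b\<in>{..k} - {a}. 3 * (of_nat a - of_nat b) :: 'a) =
      3 ^ k * ((-1) ^ (k - a) * fact a * fact (k - a))"
    using assms(2) by (subst prod.distrib) (simp add: prod_differences[OF assms(2)])
  also have "(\<Prod>b\<le>k. 3 * (of_nat a - of_nat b) + of_nat d) =
      (\<Prod>b\<le>k. - (3 * (of_nat (k - a) - of_nat b) - of_nat d) :: 'a)"
    using assms(2)
    by (intro prod.reindex_bij_witness[of _ "\<lambda>b. k - b" "\<lambda>b. k - b"]) (auto simp: of_nat_diff algebra_simps)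
  also have "\<dots> = (-1) ^ Suc k * cross_prod d k (k - a)"
    by (simp only: cross_prod_def prod_uminus card_atMost)
  also have "3 ^ k * ((-1) ^ (k - a) * fact a * fact (k - a)) * ((-1) ^ Suc k * cross_prod d k (k - a)) =
      (-1) ^ (k - a) * (-1) ^ Suc k * (3 ^ k * fact a * fact (k - a) * (cross_prod d k (k - a) :: 'a))"
    by (simp add: algebra_simps)
  also have "(-1) ^ (k - a) * (-1) ^ Suc k = (- ((-1) ^ a) :: 'a)"
    using assms(2) by (cases "even k"; cases "even a") auto
  finally show ?thesis by (simp add: algebra_simps)
qed

text \<open>Raising \<open>a\<close> by one replaces a factor at one end of
  \<open>cross_prod\<close> by a new one at the other. Combined with the changes in the two falling
  factorials, this leaves just a factor -1.\<close>

lemma cross_prod_binomials: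
  assumes "a \<le> k"
  shows "(\<Prod>j<a. of_nat k + of_nat d / 3 - of_nat j) * (\<Prod>j<k - a. of_nat k - of_nat d / 3 - of_nat j)
           * cross_prod d k a = - ((-1) ^ (k + a) * cross_const d k :: 'a::field_char_0)"
  using assms
proof (induction a)
  case 0
  have "(cross_prod d k 0 :: 'a) = (\<Prod>b\<le>k. - (3 * of_nat b + of_nat d))"
    unfolding cross_prod_def by (intro prod.cong) auto
  also have "\<dots> = (-1) ^ Suc k * (\<Prod>b\<le>k. 3 * of_nat b + of_nat d)"
    by (simp only: prod_uminus card_atMost)
  finally show ?case by (simp add: cross_const_def)
next
  case (Suc a)
  define x :: 'a where "x = (\<Prod>j<a. of_nat k + of_nat d / 3 - of_nat j)"
  define y :: 'a where "y = (\<Prod>j<k - Suc a. of_nat k - of_nat d / 3 - of_nat j)"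
  define w :: 'a where "w = (\<Prod>b<k. 3 * (of_nat a - of_nat b) - of_nat d)"
  have "k - a = Suc (k - Suc a)" using Suc.prems by simp
  then have y: "(\<Prod>j<k - a. of_nat k - of_nat d / 3 - of_nat j :: 'a) = y * (of_nat a + 1 - of_nat d / 3)"
    using Suc.prems by (simp add: y_def of_nat_diff)
  have w: "(cross_prod d k a :: 'a) = w * (3 * (of_nat a - of_nat k) - of_nat d)"
    by (simp add: cross_prod_def w_def flip: lessThan_Suc_atMost)
  have w': "(cross_prod d k (Suc a) :: 'a) = (3 * (of_nat a + 1) - of_nat d) * w"
    unfolding cross_prod_def w_def lessThan_Suc_atMost[symmetric] prod.lessThan_Suc_shift
    by (simp add: algebra_simps)
  have IH: "x * (y * (of_nat a + 1 - of_nat d / 3)) * (w * (3 * (of_nat a - of_nat k) - of_nat d))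
      = - ((-1) ^ (k + a) * cross_const d k)"
    using Suc.IH Suc.prems unfolding y w x_def by simp
  have "x * (of_nat k + of_nat d / 3 - of_nat a) * y * ((3 * (of_nat a + 1) - of_nat d) * w) =
      - (x * (y * (of_nat a + 1 - of_nat d / 3)) * (w * (3 * (of_nat a - of_nat k) - of_nat d)))"
    by (simp add: field_simps)
  then show ?case unfolding IH w' by (simp add: x_def y_def)
qed

lemma cross_const_nonzero:
  assumes "d \<in> {1, 2}"
  shows "(cross_const d k :: 'a::field_char_0) \<noteq> 0"
proof -
  have "3 * of_nat b + of_nat d \<noteq> (0 :: 'a)" for b
  proof -
    have "of_nat (3 * b + d) \<noteq> (0 :: 'a)" unfolding of_nat_eq_0_iff using assms by auto
    then show ?thesis by simp
  qed
  moreover have "of_nat k - of_nat d / 3 - of_nat j \<noteq> (0 :: 'a)" if "j < k" for j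
  proof
    assume "of_nat k - of_nat d / 3 - of_nat j = (0 :: 'a)"
    then have "of_nat (3 * k) = (of_nat (3 * j + d) :: 'a)" by (simp add: field_simps)
    then show False unfolding of_nat_eq_iff using nodes_disjoint[OF assms, of k 0 j] by simp
  qed
  ultimately show ?thesis by (simp add: cross_const_def)
qed

text \<open>Up to alternating signs, the divided-difference weights thus become the summands of
  \<open>terminating_Kummer\<close> at the parameter \<open>d / 3\<close>.\<close>

lemma inverse_node_prod:
  assumes d: "d \<in> {1, 2}" and a: "a \<le> k"
  shows "1 / ((-1) ^ (k - a) * fact a * fact (k - a) * cross_prod d k a) =
    - (((of_nat k + of_nat d / 3) gchoose a) * ((of_nat k - of_nat d / 3) gchoose (k - a)) / cross_const d k :: 'a::field_char_0)"
proof -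
  define u v P C :: 'a where "u = (of_nat k + of_nat d / 3) gchoose a"
    and "v = (of_nat k - of_nat d / 3) gchoose (k - a)" and "P = cross_prod d k a" and "C = cross_const d k"
  have C: "C \<noteq> 0" using cross_const_nonzero[OF d] by (simp add: C_def)
  have "(fact a * u) * (fact (k - a) * v) * P = - ((-1) ^ (k + a) * C)"
    using cross_prod_binomials[OF a, of d, where 'a = 'a]
    by (simp add: u_def v_def P_def C_def gbinomial_mult_fact atLeast0LessThan)
  moreover have "(-1) ^ (k + a) = ((-1) ^ (k - a) :: 'a)"
    using a by (cases "even k"; cases "even a") auto
  ultimately have *: "(fact a * u) * (fact (k - a) * v) * P = - ((-1) ^ (k - a) * C)" by simp
  with C have "P \<noteq> 0" by auto
  have "- (u * v) * ((-1) ^ (k - a) * fact a * fact (k - a) * P) =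
      - ((-1) ^ (k - a) * ((fact a * u) * (fact (k - a) * v) * P))"
    by (simp only: mult_ac mult_minus_left mult_minus_right)
  also have "\<dots> = ((-1) ^ (k - a) * (-1) ^ (k - a)) * C"
    unfolding * by (simp only: mult_minus_right minus_minus mult.assoc)
  also have "(-1) ^ (k - a) * (-1) ^ (k - a) = (1 :: 'a)"
    by (simp flip: power_mult_distrib)
  finally have "- (u * v) * ((-1) ^ (k - a) * fact a * fact (k - a) * P) = C"
    by (simp only: mult_1)
  then show ?thesis
    using C \<open>P \<noteq> 0\<close> unfolding u_def[symmetric] v_def[symmetric] P_def[symmetric] C_def[symmetric]
    by (simp add: field_simps)
qed

definition Kummer_ratio :: "nat \<Rightarrow> nat \<Rightarrow> 'a::field_char_0" where
  "Kummer_ratio d k = (-2) ^ k / fact k * (\<Prod>l<k. of_nat d / 3 - (of_nat k - 1 - 2 * of_nat l))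
     / (3 ^ k * cross_const d k)"

text \<open>Since \<open>z ^ 3 = -1\<close>, steps of 3 in the exponent supply the alternating sign
  of Kummer's sum. Both classes give the same sum, the upper one after reversing the index.\<close>

lemma node_sum:
  fixes z :: "'a::field_char_0"
  assumes d: "d \<in> {1, 2}" and z: "z ^ 3 = -1"
  shows "(\<Sum>m\<in>nodes c d k. z ^ m / (\<Prod>m'\<in>nodes c d k - {m}. of_nat m - of_nat m'))
         = - (z ^ c * (1 - (-1) ^ k * z ^ d) * Kummer_ratio d k)"
proof -
  define Q :: "nat \<Rightarrow> 'a" where
    "Q a = ((of_nat k + of_nat d / 3) gchoose a) * ((of_nat k - of_nat d / 3) gchoose (k - a))" for a
  define C :: 'a where "C = 3 ^ k * cross_const d k"
  have Q: "(\<Sum>a\<le>k. (-1) ^ a * Q a) = Kummer_ratio d k * C"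
    using terminating_Kummer[of k "of_nat d / 3 :: 'a"] cross_const_nonzero[OF d, of k, where 'a = 'a]
    by (simp add: Q_def Kummer_ratio_def C_def mult.assoc)
  have C: "C \<noteq> 0" using cross_const_nonzero[OF d, of k, where 'a = 'a] by (simp add: C_def)
  have zm: "z ^ (3 * a + e) = (-1) ^ a * z ^ e" for a e
    by (simp add: power_add power_mult z)
  have lower: "z ^ (3 * a + c) / (\<Prod>m'\<in>nodes c d k - {3 * a + c}. of_nat (3 * a + c) - of_nat m')
      = - (z ^ c / C) * ((-1) ^ a * Q a)" if "a \<le> k" for a
  proof -
    have "z ^ (3 * a + c) / (\<Prod>m'\<in>nodes c d k - {3 * a + c}. of_nat (3 * a + c) - of_nat m') =
      z ^ (3 * a + c) / 3 ^ k * (1 / ((-1) ^ (k - a) * fact a * fact (k - a) * cross_prod d k a))"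
      unfolding node_prod_lower[OF d that] by (simp add: mult.assoc)
    then show ?thesis unfolding inverse_node_prod[OF d that] zm by (simp add: Q_def C_def)
  qed
  have upper: "z ^ (3 * a + c + d) / (\<Prod>m'\<in>nodes c d k - {3 * a + c + d}. of_nat (3 * a + c + d) - of_nat m')
      = z ^ (c + d) / C * (-1) ^ k * ((-1) ^ (k - a) * Q (k - a))" if "a \<le> k" for a
  proof -
    have ka: "k - a \<le> k" "k - (k - a) = a" using that by auto
    have s: "(-1) ^ k * (-1) ^ (k - a) = ((-1) ^ a :: 'a)"
      using that by (cases "even k"; cases "even a") auto
    have "z ^ (3 * a + c + d) / (\<Prod>m'\<in>nodes c d k - {3 * a + c + d}. of_nat (3 * a + c + d) - of_nat m') =
      - (z ^ (3 * a + (c + d)) / 3 ^ k * (1 / ((-1) ^ a * fact (k - a) * fact a * cross_prod d k (k - a))))"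
      unfolding node_prod_upper[OF d that] by (simp add: mult_ac add.assoc)
    also have "\<dots> = z ^ (c + d) / C * ((-1) ^ a) * Q (k - a)"
      using inverse_node_prod[OF d ka(1), where 'a = 'a] unfolding ka(2) zm by (simp add: Q_def C_def ka(2))
    finally show ?thesis by (simp add: s[symmetric])
  qed
  have refl: "(\<Sum>a\<le>k. (-1) ^ (k - a) * Q (k - a)) = (\<Sum>a\<le>k. (-1) ^ a * Q a)"
    by (rule sum.reindex_bij_witness[of _ "\<lambda>a. k - a" "\<lambda>a. k - a"]) auto
  have "(\<Sum>a\<le>k. z ^ (3 * a + c) / (\<Prod>m'\<in>nodes c d k - {3 * a + c}. of_nat (3 * a + c) - of_nat m'))
      = - (z ^ c / C) * (\<Sum>a\<le>k. (-1) ^ a * Q a)"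
    unfolding sum_distrib_left using lower by (intro sum.cong) auto
  moreover have "(\<Sum>a\<le>k. z ^ (3 * a + c + d) / (\<Prod>m'\<in>nodes c d k - {3 * a + c + d}. of_nat (3 * a + c + d) - of_nat m'))
      = z ^ (c + d) / C * (-1) ^ k * (\<Sum>a\<le>k. (-1) ^ a * Q a)"
    unfolding refl[symmetric] unfolding sum_distrib_left using upper by (intro sum.cong) auto
  ultimately have "(\<Sum>m\<in>nodes c d k. z ^ m / (\<Prod>m'\<in>nodes c d k - {m}. of_nat m - of_nat m'))
      = - (z ^ c / C) * (\<Sum>a\<le>k. (-1) ^ a * Q a) + z ^ (c + d) / C * (-1) ^ k * (\<Sum>a\<le>k. (-1) ^ a * Q a)"
    unfolding sum_nodes[OF d] by simp
  then show ?thesis using C unfolding Q by (simp add: field_simps power_add)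
qed

section \<open>Symmetry of order three\<close>

text \<open>Multiplied by \<open>(w + 1) ^ D\<close>, each power \<open>x ^ j\<close> becomes a
  multiple of \<open>(w - 1) ^ j * (w + 1) ^ (D - j)\<close>, so the zero at \<open>x = 0\<close>
  moves to \<open>w = 1\<close>. There only the lowest power contributes to the cofactor.\<close>

lemma Moebius_vanishing:
  fixes R g :: "'a::field_char_0 poly"
  assumes deg: "degree (monom 1 N * R) \<le> D"
    and eq: "\<And>w. w \<noteq> -1 \<Longrightarrow> 2 ^ D * poly g w = (w + 1) ^ D * poly (monom 1 N * R) (c * (w - 1) / (w + 1))"
  shows "\<exists>R'. g = [:-1, 1:] ^ N * R' \<and> poly R' 1 = (c / 2) ^ N * coeff R 0"
proof -
  \<comment> \<open>The substitution has a pole at \<open>w = -1\<close>; multiplying by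
    \<open>[:1, 1:]\<close> absorbs this point.\<close>
  have cofinite_eq: "p = q" if "\<And>w. w \<noteq> -1 \<Longrightarrow> poly p w = poly q w" for p q :: "'a poly"
  proof -
    have "poly ([:1, 1:] * p) w = poly ([:1, 1:] * q) w" for w
      using that[of w] by (cases "w = -1") auto
    then have "[:1, 1:] * p = [:1, 1:] * q"
      unfolding poly_eq_poly_eq_iff[symmetric] by (rule ext)
    then show ?thesis by (subst (asm) mult_left_cancel) auto
  qed
  show ?thesis
  proof (cases "R = 0")
    case True
    then have "g = 0" using eq by (intro cofinite_eq) auto
    then show ?thesis using True by (intro exI[of _ 0]) auto
  next
    case False
    then have D: "N + degree R \<le> D"
      using deg by (subst (asm) degree_mult_eq) (auto simp: degree_monom_eq)
    define R' where "R' = smult (c ^ N / 2 ^ D)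
      (\<Sum>j\<le>D - N. smult (coeff R j * c ^ j) ([:-1, 1:] ^ j * [:1, 1:] ^ (D - N - j)))"
    have "poly R' 1 = c ^ N / 2 ^ D * (\<Sum>j\<in>{0}. coeff R j * c ^ j * (0 ^ j * 2 ^ (D - N - j)))"
      unfolding R'_def poly_smult poly_sum
      by (intro arg_cong[of _ _ "\<lambda>x. c ^ N / 2 ^ D * x"] sum.mono_neutral_cong_right) auto
    also have "\<dots> = (c / 2) ^ N * coeff R 0"
      using D by (simp add: power_divide power_diff field_simps)
    finally have R'1: "poly R' 1 = (c / 2) ^ N * coeff R 0" .
    have "g = [:-1, 1:] ^ N * R'"
    proof (rule cofinite_eq)
      fix w :: 'a assume w: "w \<noteq> -1"
      define x where "x = c * (w - 1) / (w + 1)"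
      have w1: "w + 1 \<noteq> 0" using w by (metis eq_neg_iff_add_eq_0)
      have x: "x * (w + 1) = c * (w - 1)" using w1 by (simp add: x_def)
      have summand: "(w + 1) ^ (D - N) * (coeff R j * x ^ j) = coeff R j * c ^ j * ((w - 1) ^ j * (w + 1) ^ (D - N - j))"
        if "j \<le> D - N" for j
      proof -
        have "(w + 1) ^ (D - N) = (w + 1) ^ j * (w + 1) ^ (D - N - j)"
          using that by (simp only: power_add[symmetric] le_add_diff_inverse)
        then have "(w + 1) ^ (D - N) * (coeff R j * x ^ j) = coeff R j * (x * (w + 1)) ^ j * (w + 1) ^ (D - N - j)"
          by (simp add: power_mult_distrib)
        then show ?thesis by (simp add: x power_mult_distrib)
      qed
      have "poly R x = (\<Sum>j\<le>D - N. coeff R j * x ^ j)"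
        unfolding poly_altdef using D by (intro sum.mono_neutral_left) (auto simp: coeff_eq_0)
      then have R: "(w + 1) ^ (D - N) * poly R x
          = (\<Sum>j\<le>D - N. coeff R j * c ^ j * ((w - 1) ^ j * (w + 1) ^ (D - N - j)))"
        unfolding sum_distrib_left by (simp add: sum_distrib_left summand)
      have "2 ^ D * poly g w = (w + 1) ^ D * (x ^ N * poly R x)"
        using eq[OF w] by (simp add: x_def poly_monom)
      also have "(w + 1) ^ D = (w + 1) ^ N * (w + 1) ^ (D - N)"
        using D by (simp flip: power_add)
      also have "(w + 1) ^ N * (w + 1) ^ (D - N) * (x ^ N * poly R x) =
          (x * (w + 1)) ^ N * ((w + 1) ^ (D - N) * poly R x)"
        by (simp add: power_mult_distrib)
      also have "\<dots> = 2 ^ D * poly ([:-1, 1:] ^ N * R') w"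
        unfolding R x R'_def by (simp add: poly_sum power_mult_distrib add.commute[of 1 w])
      finally show "poly g w = poly ([:-1, 1:] ^ N * R') w" by simp
    qed
    with R'1 show ?thesis by blast
  qed
qed

section \<open>The sixth root of unity and forms rotated by its square\<close>

definition eps :: complex where
  "eps = Complex (1 / 2) (sqrt 3 / 2)"

lemma eps_square: "eps * eps = eps - 1"
  by (simp add: eps_def complex_eq_iff)

lemma eps_square_left: "eps * (eps * t) = eps * t - t"
  by (simp add: eps_square left_diff_distrib flip: mult.assoc)

lemma eps_cube: "eps ^ 3 = -1"
  by (simp add: power3_eq_cube eps_square algebra_simps)

lemma one_plus_eps_nonzero: "1 + eps \<noteq> 0"
  by (simp add: eps_def complex_eq_iff)

text \<open>For \<open>I \<le> L\<close> this is \<open>u^I + u^-I\<close> with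
  \<open>u = x / y\<close>, multiplied by \<open>(x y)^L\<close> to clear denominators and make it
  homogeneous of degree \<open>2 * L\<close>.\<close>

definition sympow :: "nat \<Rightarrow> nat \<Rightarrow> 'a::comm_semiring_1 \<Rightarrow> 'a \<Rightarrow> 'a" where
  "sympow L I x y = x ^ (L + I) * y ^ (L - I) + x ^ (L - I) * y ^ (L + I)"

lemma sympow_commute: "sympow L I x y = sympow L I y x"
  by (simp add: sympow_def add.commute mult.commute)

lemma sympow_scale:
  fixes c :: "'a::comm_semiring_1"
  assumes "I \<le> L"
  shows "sympow L I (c * x) (c * y) = c ^ (2 * L) * sympow L I x y"
proof -
  have "c ^ (2 * L) = c ^ (L + I) * c ^ (L - I)"
    using assms by (simp add: mult_2 flip: power_add)
  then show ?thesis by (simp add: sympow_def power_mult_distrib algebra_simps)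
qed

lemma sympow_uminus:
  fixes x :: "'a::comm_ring_1"
  assumes "I \<le> L"
  shows "sympow L I (- x) y = (-1) ^ (L + I) * sympow L I x y"
proof -
  have "(-1) ^ (L - I) = ((-1) ^ (L + I) :: 'a)"
    using assms by (cases "even L"; cases "even I") auto
  then show ?thesis
    by (simp add: sympow_def power_minus[of x] algebra_simps)
qed

text \<open>At the arguments \<open>2\<close>, \<open>1 + v\<close>, \<open>1 - v\<close> this is,
  up to a scalar, the share of row \<open>I\<close> in \<open>odd_poly\<close>. The homogeneous form
  lets the rotation act by permuting arguments up to sign and scale.\<close>

definition triform :: "nat \<Rightarrow> nat \<Rightarrow> nat \<Rightarrow> 'a::comm_ring_1 \<Rightarrow> 'a \<Rightarrow> 'a \<Rightarrow> 'a" where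
  "triform L q I x y z = sympow L I y x * z ^ q - sympow L I z x * y ^ q"

lemma triform_scale:
  assumes "I \<le> L"
  shows "triform L q I (c * x) (c * y) (c * z) = c ^ (2 * L + q) * triform L q I x y z"
  using assms by (simp add: triform_def sympow_scale power_mult_distrib power_add algebra_simps)

text \<open>The substitution \<open>w \<mapsto> eps^2 w\<close> permutes the three linear forms used in \<open>rotpoly\<close> up to sign and a common factor \<open>eps\<close>.\<close>

lemma triform_rotation:
  assumes "I \<le> L"
  shows "triform L q I x y z + (-1) ^ q * triform L q I y (- z) x + triform L q I (- z) (- x) y = (0 :: 'a::comm_ring_1)"
proof -
  have 1: "triform L q I y (- z) x = (-1) ^ (L + I) * sympow L I z y * x ^ q - (-1) ^ q * (sympow L I x y * z ^ q)"
    using assms by (simp add: triform_def sympow_uminus power_minus[of z])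
  have "sympow L I (- x) (- z) = sympow L I (-1 * x) (-1 * z)" by simp
  also have "\<dots> = sympow L I x z" using sympow_scale[OF assms, of "-1" x z] by simp
  finally have 2: "triform L q I (- z) (- x) y = sympow L I x z * y ^ q - (-1) ^ (L + I) * (-1) ^ q * (sympow L I z y * x ^ q)"
    using assms by (simp add: triform_def sympow_commute[of L I y "- z"] sympow_uminus power_minus[of x])
  have "(-1) ^ q * ((-1) ^ q * t) = t" for t :: 'a
    by (simp flip: mult.assoc power_mult_distrib)
  \<comment> \<open>Up to sign only three products occur, one for each form raised to the power
    \<open>q\<close>; each occurs twice, with opposite signs.\<close>
  then show ?thesis unfolding 1 2 unfolding triform_def
    by (simp add: algebra_simps sympow_commute[of L I y x] sympow_commute[of L I z x] sympow_commute[of L I z y])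
qed

text \<open>In the Moebius coordinate the three linear forms are \<open>w + 1\<close> times
  \<open>1\<close>, \<open>(1 + x) / 2\<close> and \<open>(1 - x) / 2\<close>.\<close>

definition rotpoly :: "(nat \<Rightarrow> complex) \<Rightarrow> nat \<Rightarrow> nat \<Rightarrow> complex poly" where
  "rotpoly b L q = (\<Sum>I\<le>L. smult (b I) (triform L q I [:1, 1:] [:1 - eps, eps:] [:eps, 1 - eps:]))"

lemma poly_sympow: "poly (sympow L I p q) w = sympow L I (poly p w) (poly q w)"
  by (simp add: sympow_def)

lemma poly_triform: "poly (triform L q I x y z) w = triform L q I (poly x w) (poly y w) (poly z w)"
  by (simp add: triform_def poly_sympow)

lemma poly_rotpoly:
  "poly (rotpoly b L q) w = (\<Sum>I\<le>L. b I * triform L q I (w + 1) (eps * w + (1 - eps)) ((1 - eps) * w + eps))"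
  by (simp add: rotpoly_def poly_sum poly_triform algebra_simps)

lemma degree_power_le_exponent:
  assumes "degree p \<le> 1"
  shows "degree (p ^ n) \<le> n"
proof -
  have "degree (p ^ n) \<le> degree p * n" by (rule degree_power_le)
  also have "\<dots> \<le> 1 * n" by (rule mult_le_mono1[OF assms])
  finally show ?thesis by simp
qed

lemma degree_mult_le_add:
  assumes "degree p \<le> m" "degree q \<le> n"
  shows "degree (p * q) \<le> m + n"
  using degree_mult_le[of p q] assms by linarith

lemma degree_triform:
  fixes x y z :: "'a::comm_ring_1 poly"
  assumes "I \<le> L" "degree x \<le> 1" "degree y \<le> 1" "degree z \<le> 1"
  shows "degree (triform L q I x y z) \<le> 2 * L + q"
proof -
  note pow = degree_power_le_exponent and mul = degree_mult_le_add
  have sym: "degree (sympow L I p q) \<le> 2 * L" if "degree p \<le> 1" "degree q \<le> 1" for p q :: "'a poly"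
  proof -
    have "degree (p ^ (L + I) * q ^ (L - I)) \<le> (L + I) + (L - I)" "degree (p ^ (L - I) * q ^ (L + I)) \<le> (L - I) + (L + I)"
      using that by (intro mul pow; simp)+
    then show ?thesis unfolding sympow_def using assms(1) by (intro degree_add_le) auto
  qed
  show ?thesis unfolding triform_def using assms by (intro degree_diff_le mul pow sym) auto
qed

lemma degree_rotpoly: "degree (rotpoly b L q) \<le> 2 * L + q"
  unfolding rotpoly_def
  by (intro degree_sum_le order_trans[OF degree_smult_le] degree_triform) auto

text \<open>The weights \<open>eps ^ (2 * s)\<close> and \<open>eps ^ (4 * s)\<close> are chosen to
  turn the scaling factors of degree \<open>3 * k + s\<close> into the signs \<open>(-1) ^ q\<close>
  and \<open>1\<close> of \<open>triform_rotation\<close>.\<close>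

lemma rotpoly_rotation:
  assumes D: "2 * L + q = 3 * k + s"
  shows "poly (rotpoly b L q) w + eps ^ (2 * s) * poly (rotpoly b L q) (eps\<^sup>2 * w)
           + eps ^ (4 * s) * poly (rotpoly b L q) (eps ^ 4 * w) = 0"
proof -
  define x y z where "x w = w + 1" and "y w = eps * w + (1 - eps)" and "z w = (1 - eps) * w + eps" for w
  have e2: "eps\<^sup>2 = eps - 1" by (simp add: power2_eq_square eps_square)
  have rot: "x (eps\<^sup>2 * w) = eps * y w" "y (eps\<^sup>2 * w) = eps * (- z w)" "z (eps\<^sup>2 * w) = eps * x w" for w
    unfolding x_def y_def z_def e2 by (simp_all add: algebra_simps eps_square eps_square_left)
  have e4: "eps ^ 4 * w = eps\<^sup>2 * (eps\<^sup>2 * w)" by (simp add: power2_eq_square numeral_eq_Suc)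
  have q: "(-1) ^ q = ((-1) ^ (k + s) :: complex)"
  proof -
    have "even q = even (k + s)" using D by presburger
    then show ?thesis by (simp add: minus_one_power_iff)
  qed
  have "eps ^ (3 * (k + s)) = (-1) ^ (k + s)" by (simp only: power_mult eps_cube)
  then have l1: "eps ^ (2 * s) * eps ^ (2 * L + q) = (-1) ^ q"
    unfolding D q by (simp add: algebra_simps flip: power_add)
  have l2: "eps ^ (4 * s) * (eps ^ (2 * L + q) * eps ^ (2 * L + q)) = 1"
  proof -
    have "eps ^ (4 * s) * (eps ^ (2 * L + q) * eps ^ (2 * L + q)) = (eps ^ (2 * s) * eps ^ (2 * L + q)) ^ 2"
      unfolding power_add[symmetric] power_mult[symmetric] by (rule arg_cong) simp
    then show ?thesis unfolding l1 by (simp flip: power_mult)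
  qed
  have t1: "triform L q I (x (eps\<^sup>2 * w)) (y (eps\<^sup>2 * w)) (z (eps\<^sup>2 * w)) =
      eps ^ (2 * L + q) * triform L q I (y w) (- z w) (x w)" if "I \<le> L" for I w
    unfolding rot by (rule triform_scale[OF that])
  have t2: "triform L q I (x (eps ^ 4 * w)) (y (eps ^ 4 * w)) (z (eps ^ 4 * w)) =
      eps ^ (2 * L + q) * (eps ^ (2 * L + q) * triform L q I (- z w) (- x w) (y w))" if "I \<le> L" for I
  proof -
    have "triform L q I (x (eps ^ 4 * w)) (y (eps ^ 4 * w)) (z (eps ^ 4 * w)) =
        eps ^ (2 * L + q) * triform L q I (eps * (- z w)) (eps * (- x w)) (eps * y w)"
      unfolding e4 t1[OF that] unfolding rot by simp
    then show ?thesis by (simp only: triform_scale[OF that])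
  qed
  have "triform L q I (x w) (y w) (z w)
      + eps ^ (2 * s) * triform L q I (x (eps\<^sup>2 * w)) (y (eps\<^sup>2 * w)) (z (eps\<^sup>2 * w))
      + eps ^ (4 * s) * triform L q I (x (eps ^ 4 * w)) (y (eps ^ 4 * w)) (z (eps ^ 4 * w)) = 0" if "I \<le> L" for I
    using triform_rotation[OF that, of q "x w" "y w" "z w"]
    unfolding t1[OF that] t2[OF that] by (simp only: l1 l2[unfolded mult.assoc[symmetric]] mult.assoc[symmetric] mult_1)
  then have "(\<Sum>I\<le>L. b I * (triform L q I (x w) (y w) (z w)
      + eps ^ (2 * s) * triform L q I (x (eps\<^sup>2 * w)) (y (eps\<^sup>2 * w)) (z (eps\<^sup>2 * w))
      + eps ^ (4 * s) * triform L q I (x (eps ^ 4 * w)) (y (eps ^ 4 * w)) (z (eps ^ 4 * w)))) = 0"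
    by (intro sum.neutral) auto
  then show ?thesis
    unfolding poly_rotpoly x_def y_def z_def by (simp add: sum_distrib_left sum.distrib algebra_simps)
qed

text \<open>Comparing coefficients in \<open>rotpoly_rotation\<close> multiplies
  \<open>coeff (rotpoly b L q) m\<close> by
  \<open>1 + eps ^ (2 * (s + m)) + eps ^ (4 * (s + m))\<close>, which is 3 when 3 divides
  \<open>s + m\<close>.\<close>

lemma coeff_rotpoly_eq_0:
  assumes D: "2 * L + q = 3 * k + s" and m: "3 dvd s + m"
  shows "coeff (rotpoly b L q) m = 0"
proof -
  let ?g = "rotpoly b L q"
  have "?g + smult (eps ^ (2 * s)) (pcompose ?g [:0, eps\<^sup>2:]) + smult (eps ^ (4 * s)) (pcompose ?g [:0, eps ^ 4:]) = 0"
    unfolding poly_eq_poly_eq_iff[symmetric]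
    by (rule ext) (use rotpoly_rotation[OF D] in \<open>simp add: poly_pcompose mult.commute\<close>)
  then have "coeff (?g + smult (eps ^ (2 * s)) (pcompose ?g [:0, eps\<^sup>2:]) + smult (eps ^ (4 * s)) (pcompose ?g [:0, eps ^ 4:])) m = 0"
    by simp
  then have "(1 + eps ^ (2 * (s + m)) + eps ^ (4 * (s + m))) * coeff ?g m = 0"
    by (simp add: coeff_pcompose_linear power_add distrib_left distrib_right mult_ac flip: power_mult)
  moreover obtain t where t: "s + m = 3 * t" using m by auto
  have "eps ^ 6 = 1"
    using arg_cong[OF eps_cube, of "\<lambda>x. x ^ 2"] by (simp flip: power_mult)
  then have "eps ^ (6 * t) = 1" "eps ^ (12 * t) = 1"
    using power_mult[of eps 6 t] power_mult[of eps 6 "2 * t"] by simp_all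
  then have "eps ^ (2 * (s + m)) = 1" "eps ^ (4 * (s + m)) = 1"
    unfolding t by simp_all
  ultimately show ?thesis by simp
qed

section \<open>Odd parts of combinations of rows\<close>

definition row_coeff :: "int \<Rightarrow> nat \<Rightarrow> nat \<Rightarrow> 'a::field_char_0" where
  "row_coeff e I p = 4 ^ I * (of_int (e - int I) gchoose p) + (of_int (e + int I) gchoose p)"

definition row_poly :: "(nat \<Rightarrow> 'a::field_char_0) \<Rightarrow> nat \<Rightarrow> 'a poly" where
  "row_poly a L = (\<Sum>I\<le>L. smult (a I) (smult (4 ^ I) ([:1, 1:] ^ (L - I)) + [:1, 1:] ^ (L + I)))"

text \<open>For the combined row series \<open>f\<close> with \<open>e = L - q\<close>, this is
  \<open>f(x) - f(-x)\<close> times \<open>(1 - x^2)^q\<close>, which makes it a polynomial.\<close>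

definition odd_poly :: "(nat \<Rightarrow> 'a::field_char_0) \<Rightarrow> nat \<Rightarrow> nat \<Rightarrow> 'a poly" where
  "odd_poly a L q = row_poly a L * [:1, -1:] ^ q - pcompose (row_poly a L) [:0, -1:] * [:1, 1:] ^ q"

lemma row_poly_fps:
  fixes a :: "nat \<Rightarrow> 'a::field_char_0"
  assumes "e = int L - int q"
  shows "fps_of_poly (row_poly a L) = (1 + fps_X) ^ q * Abs_fps (\<lambda>p. \<Sum>I\<le>L. a I * row_coeff e I p)"
proof -
  define Y :: "'a fps" where "Y = (1 + fps_X) ^ q"
  define B :: "int \<Rightarrow> 'a fps" where "B i = fps_binomial (of_int i)" for i
  have f: "Abs_fps (\<lambda>p. \<Sum>I\<le>L. a I * row_coeff e I p) =
    (\<Sum>I\<le>L. fps_const (a I) * (fps_const (4 ^ I) * B (e - int I) + B (e + int I)))"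
    by (rule fps_ext) (simp add: fps_sum_nth row_coeff_def B_def)
  have 1: "Y * B (e - int I) = (1 + fps_X) ^ (L - I)" if "I \<le> L" for I
    using that assms by (simp add: Y_def B_def of_nat_diff flip: fps_binomial_of_nat fps_binomial_add_mult)
  have 2: "Y * B (e + int I) = (1 + fps_X) ^ (L + I)" for I
    using assms by (simp add: Y_def B_def flip: fps_binomial_of_nat fps_binomial_add_mult)
  have "Y * (fps_const (a I) * (fps_const (4 ^ I) * B (e - int I) + B (e + int I))) =
      fps_const (a I) * (fps_const (4 ^ I) * (1 + fps_X) ^ (L - I) + (1 + fps_X) ^ (L + I))" if "I \<le> L" for I
    unfolding 1[OF that, symmetric] 2[symmetric] by (simp only: distrib_left mult_ac)
  then have "(1 + fps_X) ^ q * Abs_fps (\<lambda>p. \<Sum>I\<le>L. a I * row_coeff e I p) =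
    (\<Sum>I\<le>L. fps_const (a I) * (fps_const (4 ^ I) * (1 + fps_X) ^ (L - I) + (1 + fps_X) ^ (L + I)))"
    unfolding f Y_def[symmetric] sum_distrib_left by (intro sum.cong) auto
  then show ?thesis
    by (simp add: row_poly_def fps_of_poly_sum fps_of_poly_smult fps_of_poly_add fps_of_poly_power fps_of_poly_linear')
qed

text \<open>The polynomial is \<open>U * h\<close>: \<open>h\<close> has twice the odd coefficients
  of the row series and no even ones, and \<open>U\<close> has constant term 1, so the lowest
  coefficient of \<open>h\<close> passes unchanged.\<close>

lemma odd_poly_coeff:
  fixes a :: "nat \<Rightarrow> 'a::field_char_0"
  assumes e: "e = int L - int q"
    and vanish: "\<And>j. j < k \<Longrightarrow> (\<Sum>I\<le>L. a I * row_coeff e I (2 * j + 1)) = 0"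
  shows "m < 2 * k + 1 \<Longrightarrow> coeff (odd_poly a L q) m = 0"
    and "coeff (odd_poly a L q) (2 * k + 1) = 2 * (\<Sum>I\<le>L. a I * row_coeff e I (2 * k + 1))"
proof -
  define f where "f = Abs_fps (\<lambda>p. \<Sum>I\<le>L. a I * row_coeff e I p)"
  define U :: "'a fps" where "U = (1 + fps_X) ^ q * (1 - fps_X) ^ q"
  define h where "h = f - (f oo - fps_X)"
  have h: "fps_nth h n = (1 - (-1) ^ n) * fps_nth f n" for n
    by (simp add: h_def fps_compose_uminus' algebra_simps)
  have h0: "fps_nth h n = 0" if "n < 2 * k + 1" for n
  proof (cases "even n")
    case False
    then obtain j where "n = 2 * j + 1" by (elim oddE)
    then show ?thesis using that vanish[of j] by (simp add: h f_def)
  qed (simp add: h)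
  have U0: "fps_nth U 0 = 1" by (simp add: U_def fps_power_zeroth)
  have lin: "fps_of_poly [:1, -1:] = (1 - fps_X :: 'a fps)" "fps_of_poly [:1, 1:] = (1 + fps_X :: 'a fps)"
    "fps_of_poly [:0, -1:] = (- fps_X :: 'a fps)"
    using fps_of_poly_linear'[of "-1 :: 'a"] fps_of_poly_linear'[of "1 :: 'a"]
    by (simp_all add: fps_of_poly_pCons fps_const_neg[symmetric] del: fps_const_neg)
  have "fps_of_poly (pcompose (row_poly a L) [:0, -1:]) = ((1 + fps_X) ^ q * f) oo - fps_X"
    by (simp add: fps_of_poly_pcompose lin row_poly_fps[OF e] f_def)
  also have "\<dots> = (1 - fps_X) ^ q * (f oo - fps_X)"
    by (simp add: fps_compose_mult_distrib fps_compose_power[symmetric] fps_compose_add_distrib)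
  finally have "fps_of_poly (odd_poly a L q) = U * h"
    by (simp add: odd_poly_def fps_of_poly_diff fps_of_poly_mult fps_of_poly_power lin row_poly_fps[OF e]
        U_def h_def f_def[symmetric] algebra_simps)
  then have coeff: "coeff (odd_poly a L q) m = (\<Sum>i=0..m. fps_nth U i * fps_nth h (m - i))" for m
    by (metis fps_of_poly_nth fps_mult_nth)
  show "coeff (odd_poly a L q) m = 0" if "m < 2 * k + 1" for m
    unfolding coeff using that h0 by (intro sum.neutral) auto
  have "coeff (odd_poly a L q) (2 * k + 1) = (\<Sum>i\<in>{0}. fps_nth U i * fps_nth h (2 * k + 1 - i))"
    unfolding coeff using h0 by (intro sum.mono_neutral_right) auto
  then show "coeff (odd_poly a L q) (2 * k + 1) = 2 * (\<Sum>I\<le>L. a I * row_coeff e I (2 * k + 1))"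
    by (simp add: U0 h f_def)
qed

lemma degree_odd_poly: "degree (odd_poly a L q) \<le> 2 * L + q"
proof -
  note pow = degree_power_le_exponent and mul = degree_mult_le_add
  have row: "degree (row_poly a L) \<le> 2 * L"
    unfolding row_poly_def
    by (intro degree_sum_le order_trans[OF degree_smult_le] degree_add_le order_trans[OF pow]) auto
  have "degree (pcompose (row_poly a L) [:0, -1:]) \<le> 2 * L"
    using degree_pcompose_le[of "row_poly a L" "[:0, -1:]"] row by simp
  then show ?thesis
    unfolding odd_poly_def using row by (intro degree_diff_le mul pow) auto
qed

text \<open>Scaling the triple \<open>2\<close>, \<open>1 + x\<close>, \<open>1 - x\<close> by
  \<open>w + 1\<close> gives twice the triple of linear forms in \<open>rotpoly\<close>; homogeneity
  of degree \<open>2 * L + q\<close> does the rest.\<close>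

lemma odd_poly_eq_rotpoly:
  fixes a :: "nat \<Rightarrow> complex"
  assumes w: "w \<noteq> -1"
  shows "2 ^ (2 * L + q) * poly (rotpoly (\<lambda>I. a I * 2 ^ I / 2 ^ L) L q) w =
    (w + 1) ^ (2 * L + q) * poly (odd_poly a L q) ((2 * eps - 1) * (w - 1) / (w + 1))"
proof -
  define x where "x = (2 * eps - 1) * (w - 1) / (w + 1)"
  define y z where "y = eps * w + (1 - eps)" and "z = (1 - eps) * w + eps"
  have w1: "w + 1 \<noteq> 0" using w by (metis eq_neg_iff_add_eq_0)
  have y_eq: "(w + 1) * (1 + x) = 2 * y" and z_eq: "(w + 1) * (1 - x) = 2 * z"
    using w1 by (simp_all add: x_def y_def z_def field_simps)
  \<comment> \<open>Making a row homogeneous in \<open>1 + v\<close> and 2 costs powers of 2; this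
    is the source of the weights \<open>2 ^ I / 2 ^ L\<close>.\<close>
  have row: "poly (row_poly a L) v = (\<Sum>I\<le>L. a I * 2 ^ I / 2 ^ L * sympow L I (1 + v) 2)" for v
  proof -
    have "a I * (4 ^ I * (1 + v) ^ (L - I) + (1 + v) ^ (L + I)) = a I * 2 ^ I / 2 ^ L * sympow L I (1 + v) 2"
      if "I \<le> L" for I
    proof -
      have "2 ^ I * 2 ^ (L + I) = 2 ^ L * (2 ^ I * 2 ^ I :: complex)"
        by (simp only: power_add mult_ac)
      also have "2 ^ I * 2 ^ I = (4 ^ I :: complex)"
        by (simp flip: power_mult_distrib)
      finally have h1: "2 ^ I * 2 ^ (L + I) = (2 ^ L * 4 ^ I :: complex)" .
      have h2: "2 ^ I * 2 ^ (L - I) = (2 ^ L :: complex)"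
        using that by (simp only: power_add[symmetric] le_add_diff_inverse)
      have "2 ^ I * sympow L I (1 + v) 2 =
          (1 + v) ^ (L + I) * (2 ^ I * 2 ^ (L - I)) + (1 + v) ^ (L - I) * (2 ^ I * 2 ^ (L + I))"
        by (simp only: sympow_def distrib_left mult_ac)
      also have "\<dots> = 2 ^ L * (4 ^ I * (1 + v) ^ (L - I) + (1 + v) ^ (L + I))"
        unfolding h1 h2 by (simp only: distrib_left mult_ac add_ac)
      finally have "2 ^ I * sympow L I (1 + v) 2 = 2 ^ L * (4 ^ I * (1 + v) ^ (L - I) + (1 + v) ^ (L + I))" .
      then have "2 ^ I * sympow L I (1 + v) 2 / 2 ^ L = 4 ^ I * (1 + v) ^ (L - I) + (1 + v) ^ (L + I)"
        by simp
      then show ?thesis by (simp only: times_divide_eq_right[symmetric] times_divide_eq_left mult.assoc)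
    qed
    then show ?thesis by (simp add: row_poly_def poly_sum add.commute)
  qed
  define b where "b I = a I * 2 ^ I / 2 ^ L" for I
  have "poly (odd_poly a L q) x =
      (\<Sum>I\<le>L. b I * sympow L I (1 + x) 2) * (1 - x) ^ q - (\<Sum>I\<le>L. b I * sympow L I (1 - x) 2) * (1 + x) ^ q"
    by (simp add: odd_poly_def poly_pcompose row b_def)
  also have "\<dots> = (\<Sum>I\<le>L. b I * triform L q I 2 (1 + x) (1 - x))"
    by (simp only: sum_distrib_right sum_subtractf[symmetric] triform_def right_diff_distrib mult.assoc)
  finally have "(w + 1) ^ (2 * L + q) * poly (odd_poly a L q) x =
      (\<Sum>I\<le>L. b I * ((w + 1) ^ (2 * L + q) * triform L q I 2 (1 + x) (1 - x)))"
    by (simp only: sum_distrib_left mult_ac)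
  also have "\<dots> = (\<Sum>I\<le>L. b I * triform L q I ((w + 1) * 2) ((w + 1) * (1 + x)) ((w + 1) * (1 - x)))"
    by (intro sum.cong refl) (simp only: atMost_iff triform_scale)
  also have "\<dots> = (\<Sum>I\<le>L. b I * triform L q I (2 * (w + 1)) (2 * y) (2 * z))"
    by (simp only: y_eq z_eq mult.commute[of _ 2])
  also have "\<dots> = (\<Sum>I\<le>L. b I * (2 ^ (2 * L + q) * triform L q I (w + 1) y z))"
    by (intro sum.cong refl) (simp only: atMost_iff triform_scale)
  also have "\<dots> = 2 ^ (2 * L + q) * poly (rotpoly b L q) w"
    unfolding poly_rotpoly y_def z_def by (simp only: sum_distrib_left mult_ac)
  finally show ?thesis by (simp add: x_def b_def[abs_def])
qed

text \<open>The point \<open>w = eps\<close> corresponds to \<open>x = -1\<close>: one linear form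
  vanishes and the other two equal \<open>1 + eps\<close>. The factor \<open>0 ^ (L - I)\<close>
  then selects \<open>I = L\<close>.\<close>

lemma rotpoly_at_eps:
  assumes "L \<ge> 1" "q \<ge> 1"
  shows "poly (rotpoly b L q) eps = b L * (1 + eps) ^ (2 * L + q)"
proof -
  have "triform L q I (eps + 1) (eps * eps + (1 - eps)) ((1 - eps) * eps + eps) =
      (if I = L then (1 + eps) ^ (2 * L + q) else 0)" if "I \<le> L" for I
  proof -
    have eqs: "eps * eps + (1 - eps) = 0" "(1 - eps) * eps + eps = 1 + eps" "eps + 1 = 1 + eps"
      by (simp_all add: eps_square algebra_simps)
    have "0 ^ q = (0 :: complex)" "0 ^ (L + I) = (0 :: complex)" using assms by simp_all
    then have "triform L q I (1 + eps) 0 (1 + eps) = 0 ^ (L - I) * (1 + eps) ^ (L + I) * (1 + eps) ^ q"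
      by (simp only: triform_def sympow_def mult_zero_left mult_zero_right add_0_left diff_zero)
    also have "\<dots> = (if I = L then (1 + eps) ^ (2 * L + q) else 0)"
    proof (cases "I = L")
      case True
      then show ?thesis by (simp only: diff_self_eq_0 power_0 mult_1 power_add mult_2 if_True refl)
    next
      case False
      then have "L - I \<noteq> 0" using that by simp
      then have "0 ^ (L - I) = (0 :: complex)" by (simp only: power_0_left if_False)
      then show ?thesis using False by (simp only: mult_zero_left if_False)
    qed
    finally show ?thesis unfolding eqs .
  qed
  then have "poly (rotpoly b L q) eps = (\<Sum>I\<le>L. if I = L then b I * (1 + eps) ^ (2 * L + q) else 0)"
    unfolding poly_rotpoly by (intro sum.cong) auto
  then show ?thesis by simp
qed

text \<open>For \<open>s\<close> from 1 to 3, the least exponent whose sum with \<open>s\<close> is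
  not divisible by 3; \<open>node_gap\<close> is the distance to the next one.\<close>

definition node_start :: "nat \<Rightarrow> nat" where
  "node_start s = (if s = 3 then 1 else 0)"

definition node_gap :: "nat \<Rightarrow> nat" where
  "node_gap s = (if s = 2 then 2 else 1)"

lemma node_gap: "node_gap s \<in> {1, 2}"
  by (simp add: node_gap_def)

lemma in_nodes:
  assumes s: "s \<in> {1, 2, 3}" and m: "m \<le> 3 * k + s" "\<not> 3 dvd s + m"
  shows "m \<in> nodes (node_start s) (node_gap s) k"
proof -
  define t where "t = m div 3"
  have "s = 1 \<and> (m = 3 * t \<or> m = 3 * t + 1) \<and> t \<le> k \<or>
      s = 2 \<and> (m = 3 * t \<or> m = 3 * t + 2) \<and> t \<le> k \<or>
      s = 3 \<and> (m = 3 * t + 1 \<or> m = 3 * t + 2) \<and> t \<le> k"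
    using s m unfolding t_def insert_iff empty_iff by presburger
  then have "m = 3 * t + node_start s \<or> m = 3 * t + node_start s + node_gap s" "t \<le> k"
    by (auto simp: node_start_def node_gap_def)
  then show ?thesis unfolding nodes_def by blast
qed

text \<open>The 2 comes from the odd part, the factorial and the power of
  \<open>(2 * eps - 1) / 2\<close> from the zero at \<open>w = 1\<close>, the rest from
  \<open>node_sum\<close> at \<open>eps\<close>.\<close>

definition step_const :: "nat \<Rightarrow> nat \<Rightarrow> complex" where
  "step_const s k = 2 * fact (2 * k + 1) * ((2 * eps - 1) / 2) ^ (2 * k + 1)
     * (eps ^ node_start s * (1 - (-1) ^ k * eps ^ node_gap s) * Kummer_ratio (node_gap s) k)"

text \<open>The value of \<open>rotpoly\<close> at \<open>eps\<close> is computed twice: directly it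
  shows the top coefficient, and through sparsity it is determined by the leading behaviour at
  \<open>w = 1\<close>, hence by the coefficient at \<open>2 * k + 1\<close>.\<close>

lemma step_relation:
  fixes a :: "nat \<Rightarrow> complex"
  assumes s: "s \<in> {1, 2, 3}" and D: "2 * L + q = 3 * k + s" and Lq: "L \<ge> 1" "q \<ge> 1"
    and e: "e = int L - int q"
    and vanish: "\<And>j. j < k \<Longrightarrow> (\<Sum>I\<le>L. a I * row_coeff e I (2 * j + 1)) = 0"
  shows "a L * (1 + eps) ^ (3 * k + s) = - step_const s k * (\<Sum>I\<le>L. a I * row_coeff e I (2 * k + 1))"
proof -
  let ?N = "2 * k + 1" and ?E = "nodes (node_start s) (node_gap s) k"
  define b where "b I = a I * 2 ^ I / 2 ^ L" for I
  define S where "S = (\<Sum>I\<le>L. a I * row_coeff e I ?N)"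
  note coeffs = odd_poly_coeff[OF e vanish]
  obtain R where R: "odd_poly a L q = monom 1 ?N * R"
    using coeffs(1) monom_1_dvd_iff'[of ?N "odd_poly a L q"] by (metis dvdE)
  have "coeff R 0 = coeff (odd_poly a L q) ?N"
    unfolding R by (simp add: coeff_monom_mult)
  then have R0: "coeff R 0 = 2 * S" using coeffs(2) by (simp add: S_def)
  obtain R' where R': "rotpoly b L q = [:-1, 1:] ^ ?N * R'" "poly R' 1 = ((2 * eps - 1) / 2) ^ ?N * coeff R 0"
    using Moebius_vanishing[of ?N R "2 * L + q" "rotpoly b L q" "2 * eps - 1"]
      degree_odd_poly[of a L q] odd_poly_eq_rotpoly[of _ L q a] unfolding R b_def by blast
  have "coeff (rotpoly b L q) m = 0" if "m \<notin> ?E" for m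
  proof (cases "m \<le> 3 * k + s")
    case True
    then show ?thesis using in_nodes[OF s] that coeff_rotpoly_eq_0[OF D] by blast
  next
    case False
    then show ?thesis using degree_rotpoly[of b L q] D by (intro coeff_eq_0) auto
  qed
  then have "poly (rotpoly b L q) eps = fact ?N * poly R' 1 *
      (\<Sum>m\<in>?E. eps ^ m / (\<Prod>m'\<in>?E - {m}. of_nat m - of_nat m'))"
    using sparse_poly_eval[OF finite_nodes card_nodes[OF node_gap] R'(1)] by simp
  also have "\<dots> = - step_const s k * S"
    unfolding node_sum[OF node_gap eps_cube] R'(2) R0 step_const_def
    by (simp only: mult_minus_left mult_minus_right mult_ac)
  finally show ?thesis
    unfolding rotpoly_at_eps[OF Lq] S_def D by (simp add: b_def)
qed

section \<open>The ratio of consecutive determinants\<close>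

lemma cross_const_add_2:
  "cross_const d (k + 2) = (cross_const d k * ((3 * of_nat k + 3 + of_nat d) * (3 * of_nat k + 6 + of_nat d)
     * (of_nat k + 2 - of_nat d / 3) * (of_nat k + 1 - of_nat d / 3)) :: 'a::field_char_0)"
proof -
  have shift: "(\<Prod>j<Suc k. of_nat (Suc k) - of_nat d / 3 - of_nat j) =
      (of_nat k + 1 - of_nat d / 3) * (\<Prod>j<k. of_nat k - of_nat d / 3 - of_nat j :: 'a)" for k
    unfolding prod.lessThan_Suc_shift by (simp add: algebra_simps)
  have up: "(\<Prod>b\<le>Suc k. 3 * of_nat b + of_nat d) =
      (\<Prod>b\<le>k. 3 * of_nat b + of_nat d) * (3 * of_nat k + 3 + of_nat d :: 'a)" for k
    unfolding prod.atMost_Suc by (simp add: algebra_simps)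
  have *: "3 * of_nat (Suc k) + 3 + of_nat d = (3 * of_nat k + 6 + of_nat d :: 'a)"
    "of_nat (Suc k) + 1 - of_nat d / 3 = (of_nat k + 2 - of_nat d / 3 :: 'a)"
    by simp_all
  show ?thesis
    unfolding cross_const_def add_2_eq_Suc' shift up * by (simp only: mult_ac)
qed

text \<open>The roots in Kummer's product form a progression with difference 2 centred at 0, so
  passing from \<open>k\<close> to \<open>k + 2\<close> only adds a factor at each end.\<close>

lemma Kummer_ratio_add_2:
  assumes d: "d \<in> {1, 2}"
  shows "Kummer_ratio d (k + 2) * (9 * (of_nat k + 1) * (of_nat k + 2) * (3 * of_nat k + 6 + of_nat d) * (3 * of_nat k + 6 - of_nat d))
    = - 4 * (Kummer_ratio d k :: 'a::field_char_0)"
proof -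
  define K :: 'a where "K = of_nat k"
  define \<delta> :: 'a where "\<delta> = of_nat d / 3"
  define P where "P = (\<Prod>l<k. \<delta> - (K - 1 - 2 * of_nat l))"
  have "(\<Prod>l<k + 2. \<delta> - (of_nat (k + 2) - 1 - 2 * of_nat l)) =
      (\<delta> - (K + 1)) * (P * (\<delta> + (K + 1)))"
  proof -
    have "(\<Prod>l<k + 2. \<delta> - (of_nat (k + 2) - 1 - 2 * of_nat l)) =
      (\<delta> - (of_nat (k + 2) - 1 - 2 * of_nat 0)) * ((\<Prod>l<k. \<delta> - (of_nat (k + 2) - 1 - 2 * of_nat (Suc l)))
        * (\<delta> - (of_nat (k + 2) - 1 - 2 * of_nat (Suc k))))"
      unfolding add_2_eq_Suc' prod.lessThan_Suc_shift[of _ "Suc k"] prod.lessThan_Suc[of _ k] ..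
    then show ?thesis by (simp add: P_def K_def algebra_simps)
  qed
  then have K2: "Kummer_ratio d (k + 2) = (-2) ^ (k + 2) / fact (k + 2) * ((\<delta> - (K + 1)) * (P * (\<delta> + (K + 1))))
     / (3 ^ (k + 2) * cross_const d (k + 2))"
    by (simp add: Kummer_ratio_def \<delta>_def)
  have K0: "Kummer_ratio d k = (-2) ^ k / fact k * P / (3 ^ k * cross_const d k)"
    by (simp add: Kummer_ratio_def P_def K_def \<delta>_def)
  have fact: "fact (k + 2) = (K + 1) * (K + 2) * (fact k :: 'a)"
    by (simp add: K_def algebra_simps)
  have cross: "cross_const d (k + 2) = cross_const d k * (9 * (K + 1 + \<delta>) * (K + 2 + \<delta>) * (K + 2 - \<delta>) * (K + 1 - \<delta>))"
    unfolding cross_const_add_2 by (simp add: K_def \<delta>_def algebra_simps)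
  have factors: "3 * K + 6 + of_nat d = 3 * (K + 2 + \<delta>)" "3 * K + 6 - of_nat d = 3 * (K + 2 - \<delta>)"
    by (simp_all add: \<delta>_def)
  have nz: "cross_const d k \<noteq> (0 :: 'a)" "cross_const d (k + 2) \<noteq> (0 :: 'a)"
    using cross_const_nonzero[OF d] by auto
  have nz1: "K + 1 \<noteq> 0" "K + 2 \<noteq> 0"
    using of_nat_eq_0_iff[of "k + 1", where 'a = 'a] of_nat_eq_0_iff[of "k + 2", where 'a = 'a]
    by (simp_all add: K_def add.commute del: of_nat_eq_0_iff)
  have nz2: "K + 1 + \<delta> \<noteq> 0" "K + 2 + \<delta> \<noteq> 0" "K + 2 - \<delta> \<noteq> 0" "K + 1 - \<delta> \<noteq> 0"
    using nz unfolding cross by (simp_all only: mult_eq_0_iff de_Morgan_disj simp_thms)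
  have cancel: "w * 4 / (A * B * f) * ((- t) * (R * p)) / (h * 9 * (c * (9 * p * q * r * t))) * (9 * A * B * (3 * q) * (3 * r))
      = - 4 * (w / f * R / (h * c))"
    if "A \<noteq> 0" "B \<noteq> 0" "f \<noteq> 0" "h \<noteq> 0" "c \<noteq> 0" "p \<noteq> 0" "q \<noteq> 0" "r \<noteq> 0" "t \<noteq> 0"
    for w A B f t R p h c q r :: 'a
    using that by (simp add: field_simps)
  have pows: "(-2) ^ (k + 2) = (-2) ^ k * (4 :: 'a)" "3 ^ (k + 2) = 3 ^ k * (9 :: 'a)"
    "\<delta> - (K + 1) = - (K + 1 - \<delta>)" "\<delta> + (K + 1) = K + 1 + \<delta>"
    by (simp_all add: power_add)
  have "fact k \<noteq> (0 :: 'a)" "3 ^ k \<noteq> (0 :: 'a)" by simp_all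
  then show ?thesis
    unfolding K2 K0 fact cross K_def[symmetric] unfolding factors pows
    by (rule cancel[OF nz1 _ _ nz(1) nz2])
qed

text \<open>A step of two leaves \<open>(-1) ^ k\<close>, hence \<open>Z\<close>, unchanged, and
  \<open>V * V = - 3 / 4\<close> keeps the remaining change rational.\<close>

lemma step_const_add_2:
  fixes s :: nat
  defines "d \<equiv> node_gap s"
  shows "step_const s (k + 2) * (((3 * of_nat k + 6)\<^sup>2 - of_nat d ^ 2)) =
    - ((2 * of_nat k + 3) * (2 * of_nat k + 5)) * step_const s k"
proof -
  define K :: complex where "K = of_nat k"
  define Z where "Z = eps ^ node_start s * (1 - (-1) ^ k * eps ^ node_gap s)"
  define V where "V = (2 * eps - 1) / 2"
  have V2: "V * V = - 3 / 4"
    by (simp add: V_def algebra_simps eps_square eps_square_left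
        add_divide_distrib diff_divide_distrib)
  have V4: "V ^ (2 * (k + 2) + 1) = 9 / 16 * V ^ (2 * k + 1)"
  proof -
    have "V ^ (2 * (k + 2) + 1) = (V * V) * (V * V) * V ^ (2 * k + 1)"
      by (simp add: algebra_simps)
    then show ?thesis unfolding V2 by simp
  qed
  have fact: "fact (2 * (k + 2) + 1) = (2 * K + 2) * (2 * K + 3) * (2 * K + 4) * (2 * K + 5) * (fact (2 * k + 1) :: complex)"
    by (simp add: K_def algebra_simps)
  have K: "Kummer_ratio d (k + 2) * (9 * (K + 1) * (K + 2) * (3 * K + 6 + of_nat d) * (3 * K + 6 - of_nat d)) = - 4 * Kummer_ratio d k"
    unfolding K_def d_def by (rule Kummer_ratio_add_2[OF node_gap])
  have regroup: "2 * ((2 * K + 2) * (2 * K + 3) * (2 * K + 4) * (2 * K + 5) * f) * (9 / 16 * v) * (Z * x) * ((3 * K + 6)\<^sup>2 - g\<^sup>2) =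
      2 * f * v * Z * ((2 * K + 3) * (2 * K + 5) / 4) * (x * (9 * (K + 1) * (K + 2) * (3 * K + 6 + g) * (3 * K + 6 - g)))"
    for f v x g
  proof -
    have sq: "(3 * K + 6)\<^sup>2 - g\<^sup>2 = (3 * K + 6 + g) * (3 * K + 6 - g)"
      by (simp add: power2_eq_square algebra_simps)
    have "2 * K + 2 = 2 * (K + 1)" "2 * K + 4 = 2 * (K + 2)" by simp_all
    then show ?thesis unfolding sq by (simp only: mult_ac times_divide_eq_left times_divide_eq_right) simp
  qed
  have "(-1) ^ (k + 2) = ((-1) ^ k :: complex)" by simp
  then have "step_const s (k + 2) = 2 * ((2 * K + 2) * (2 * K + 3) * (2 * K + 4) * (2 * K + 5) * fact (2 * k + 1))
      * (9 / 16 * V ^ (2 * k + 1)) * (Z * Kummer_ratio d (k + 2))"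
    by (simp only: step_const_def V_def[symmetric] V4 fact Z_def d_def)
  then have "step_const s (k + 2) * ((3 * K + 6)\<^sup>2 - of_nat d ^ 2) =
      2 * fact (2 * k + 1) * V ^ (2 * k + 1) * Z * ((2 * K + 3) * (2 * K + 5) / 4)
        * (Kummer_ratio d (k + 2) * (9 * (K + 1) * (K + 2) * (3 * K + 6 + of_nat d) * (3 * K + 6 - of_nat d)))"
    by (simp only: regroup)
  also have "\<dots> = - ((2 * K + 3) * (2 * K + 5)) * step_const s k"
    unfolding K unfolding step_const_def V_def[symmetric] by (simp add: Z_def d_def)
  finally show ?thesis by (simp add: K_def)
qed

text \<open>For \<open>s\<close> from 1 to 3 this is
  \<open>(1 + eps) ^ (3 * k + s) / step_const s k\<close>; the recursion combines
  \<open>step_const_add_2\<close> with \<open>(1 + eps) ^ 6 = -27\<close>.\<close>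

fun step_ratio :: "nat \<Rightarrow> nat \<Rightarrow> real" where
  "step_ratio s 0 = real s"
| "step_ratio s (Suc 0) = (if s = 1 then 8 else if s = 2 then 15 else 24)"
| "step_ratio s (Suc (Suc k)) =
    27 * ((3 * real k + 6)\<^sup>2 - real (node_gap s) ^ 2) / ((2 * real k + 3) * (2 * real k + 5)) * step_ratio s k"

lemma step_ratio_const:
  assumes s: "s \<in> {1, 2, 3}"
  shows "(1 + eps) ^ (3 * k + s) = of_real (step_ratio s k) * step_const s k"
proof (induction k rule: induct_nat_012)
  case 0
  show ?case using s
    by (auto simp: step_const_def node_start_def node_gap_def Kummer_ratio_def cross_const_def
        numeral_eq_Suc algebra_simps eps_square eps_square_left
        add_divide_distrib diff_divide_distrib)
next
  case 1
  show ?case using s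
    by (auto simp: step_const_def node_start_def node_gap_def Kummer_ratio_def cross_const_def
        numeral_eq_Suc algebra_simps eps_square eps_square_left
        add_divide_distrib diff_divide_distrib)
next
  case (ge2 k)
  define K :: complex where "K = of_nat k"
  define g :: complex where "g = of_nat (node_gap s)"
  have six: "(1 + eps) ^ 6 = -27"
    by (simp add: numeral_eq_Suc algebra_simps eps_square eps_square_left
        add_divide_distrib diff_divide_distrib)
  have "of_nat (2 * k + 3) \<noteq> (0 :: complex)" "of_nat (2 * k + 5) \<noteq> (0 :: complex)"
    unfolding of_nat_eq_0_iff by auto
  then have nz: "2 * K + 3 \<noteq> 0" "2 * K + 5 \<noteq> 0" by (simp_all add: K_def)
  have rec: "step_const s (Suc (Suc k)) * ((3 * K + 6)\<^sup>2 - g ^ 2) = - ((2 * K + 3) * (2 * K + 5)) * step_const s k"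
    using step_const_add_2[of s k] by (simp add: K_def g_def)
  have cancel: "27 / (x * y) * r * (- (x * y) * c) = - 27 * (r * c)" if "x \<noteq> 0" "y \<noteq> 0" for x y r c :: complex
    using that by simp
  have "of_real (step_ratio s (Suc (Suc k))) * step_const s (Suc (Suc k)) =
      27 / ((2 * K + 3) * (2 * K + 5)) * of_real (step_ratio s k) * (step_const s (Suc (Suc k)) * ((3 * K + 6)\<^sup>2 - g ^ 2))"
    by (simp add: K_def g_def)
  also have "\<dots> = - 27 * (of_real (step_ratio s k) * step_const s k)"
    unfolding rec by (rule cancel[OF nz])
  also have "\<dots> = (1 + eps) ^ 6 * (1 + eps) ^ (3 * k + s)"
    unfolding six ge2.IH(1) by simp
  also have "\<dots> = (1 + eps) ^ (3 * Suc (Suc k) + s)"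
    by (simp add: power_add[symmetric] algebra_simps)
  finally show ?case by simp
qed

text \<open>In \<open>step_relation\<close>, \<open>step_const\<close> becomes a common factor once
  \<open>step_ratio_const\<close> is inserted. It is nonzero because \<open>1 + eps\<close> is, so
  it cancels and a real identity remains.\<close>

lemma row_sum_ratio:
  fixes a :: "nat \<Rightarrow> real"
  assumes s: "s \<in> {1, 2, 3}" and D: "2 * L + q = 3 * k + s" and Lq: "L \<ge> 1" "q \<ge> 1"
    and e: "e = int L - int q"
    and vanish: "\<And>j. j < k \<Longrightarrow> (\<Sum>I\<le>L. a I * row_coeff e I (2 * j + 1)) = 0"
  shows "(\<Sum>I\<le>L. a I * row_coeff e I (2 * k + 1)) = - step_ratio s k * a L"
proof -
  have gch: "of_real (x gchoose n) = (of_real x gchoose n :: complex)" for x n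
    by (simp add: gbinomial_prod_rev)
  have rc: "of_real (row_coeff e I p) = (row_coeff e I p :: complex)" for I p
    by (simp add: row_coeff_def gch)
  have sum: "(\<Sum>I\<le>L. of_real (a I) * row_coeff e I p) = (of_real (\<Sum>I\<le>L. a I * row_coeff e I p) :: complex)" for p
    by (simp add: rc)
  have vanish': "(\<Sum>I\<le>L. of_real (a I) * row_coeff e I (2 * j + 1)) = (0 :: complex)" if "j < k" for j
    unfolding sum vanish[OF that] by simp
  have "of_real (a L) * (of_real (step_ratio s k) * step_const s k) =
      - step_const s k * of_real (\<Sum>I\<le>L. a I * row_coeff e I (2 * k + 1))"
    using step_relation[OF s D Lq e vanish'] unfolding sum step_ratio_const[OF s] .
  then have "step_const s k * of_real ((\<Sum>I\<le>L. a I * row_coeff e I (2 * k + 1)) + step_ratio s k * a L) = 0"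
    by (simp add: algebra_simps)
  moreover have "step_const s k \<noteq> 0"
    using step_ratio_const[OF s, of k] one_plus_eps_nonzero by (metis mult_zero_right power_not_zero)
  ultimately have "of_real ((\<Sum>I\<le>L. a I * row_coeff e I (2 * k + 1)) + step_ratio s k * a L) = (0 :: complex)"
    by (metis mult_eq_0_iff)
  then show ?thesis unfolding of_real_eq_0_iff by simp
qed

text \<open>
  For \<open>\<alpha> = 2 t + 1\<close> the first \<open>t\<close> odd columns are missing; the assumption \<open>filler\<close> says that the rows with \<open>I < r + t\<close>
  can cancel whatever a combination of the remaining rows has in these columns.
\<close>

lemma det_extended_rows_step:
  fixes r s t m :: nat and e :: int
  defines "M \<equiv> \<lambda>i j. - (row_coeff e (i + (r + t)) (2 * j + (2 * t + 1)) :: real)"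
  assumes s: "s \<in> {1, 2, 3}" and e: "e = 3 * int r - int s"
    and large: "2 * r < m + t + s" "1 \<le> m + r + t"
    and filler: "\<And>v :: nat \<Rightarrow> real. \<exists>c. \<forall>j. (\<Sum>I<r + t. c I * row_coeff e I (2 * j + 1)) = (if j < t then v j else 0)"
  shows "det (mat (Suc m) (Suc m) (\<lambda>(i, j). M i j)) = step_ratio s (m + t) * det (mat m m (\<lambda>(i, j). M i j))"
proof (rule det_Suc_ratio)
  fix a assume a: "\<And>j. j < m \<Longrightarrow> (\<Sum>i\<le>m. a i * M i j) = 0"
  \<comment> \<open>With \<open>L = m + (r + t)\<close> this choice gives both
    \<open>2 * L + q = 3 * (m + t) + s\<close> and \<open>e = L - q\<close>; the assumption
    \<open>large\<close> makes it positive.\<close>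
  define q where "q = m + t + s - 2 * r"
  define v where "v j = - (\<Sum>i\<le>m. a i * row_coeff e (i + (r + t)) (2 * j + 1))" for j
  obtain c where c: "\<And>j. (\<Sum>I<r + t. c I * row_coeff e I (2 * j + 1)) = (if j < t then v j else 0)"
    using filler[of v] by auto
  \<comment> \<open>Filler rows in front of the given ones: the combination now starts at
    \<open>I = 0\<close> and also vanishes in the \<open>t\<close> missing columns.\<close>
  define a' where "a' I = (if I < r + t then c I else a (I - (r + t)))" for I
  define L where "L = m + (r + t)"
  have split: "(\<Sum>I\<le>L. a' I * row_coeff e I p) =
      (\<Sum>I<r + t. c I * row_coeff e I p) + (\<Sum>i\<le>m. a i * row_coeff e (i + (r + t)) p)" for p
  proof -
    have "{..L} = {..<r + t} \<union> {r + t..L}" by (auto simp: L_def)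
    then have "(\<Sum>I\<le>L. a' I * row_coeff e I p) =
        (\<Sum>I<r + t. a' I * row_coeff e I p) + (\<Sum>I=r + t..L. a' I * row_coeff e I p)"
      by (simp only:) (rule sum.union_disjoint, auto)
    also have "(\<Sum>I=r + t..L. a' I * row_coeff e I p) = (\<Sum>i\<le>m. a i * row_coeff e (i + (r + t)) p)"
      by (rule sum.reindex_bij_witness[of _ "\<lambda>i. i + (r + t)" "\<lambda>I. I - (r + t)"]) (auto simp: a'_def L_def)
    finally show ?thesis by (simp add: a'_def)
  qed
  have tail: "(\<Sum>I\<le>L. a' I * row_coeff e I (2 * (j + t) + 1)) = - (\<Sum>i\<le>m. a i * M i j)" for j
    unfolding split c by (simp add: M_def sum_negf algebra_simps)
  have "(\<Sum>I\<le>L. a' I * row_coeff e I (2 * j + 1)) = 0" if "j < m + t" for j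
  proof (cases "j < t")
    case True
    then show ?thesis unfolding split c by (simp add: v_def)
  next
    case False
    then show ?thesis using tail[of "j - t"] a[of "j - t"] that by simp
  qed
  moreover have "2 * L + q = 3 * (m + t) + s" "e = int L - int q" "1 \<le> L" "1 \<le> q"
    using large e by (auto simp: L_def q_def of_nat_diff)
  ultimately have "(\<Sum>I\<le>L. a' I * row_coeff e I (2 * (m + t) + 1)) = - step_ratio s (m + t) * a' L"
    by (intro row_sum_ratio[OF s]) auto
  moreover have "a' L = a m" by (simp add: a'_def L_def)
  ultimately show "(\<Sum>i\<le>m. a i * M i m) = step_ratio s (m + t) * a m"
    unfolding tail by simp
qed

text \<open>Negating the upper index gives both binomials a minus sign, since the lower index
  \<open>2 * j + p\<close> is odd.\<close>

lemma F_eq_det: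
  assumes "odd p" "\<alpha> = int p" "\<beta> = int b" "\<gamma> = int p - e + int b - 1" "\<delta> = int p - e - int b - 1"
  shows "F \<alpha> \<beta> \<gamma> \<delta> n = det (mat n n (\<lambda>(i, j). - row_coeff e (i + b) (2 * j + p)))"
proof -
  have neg: "x gchoose (2 * j + p) = - ((of_nat (2 * j + p) - x - 1) gchoose (2 * j + p))" for x :: real and j
    using gbinomial_negated_upper[of x "2 * j + p"] assms(1) by simp
  have "4 powi (int i + \<beta>) * int_binom (int i + 2 * int j + \<gamma>) (2 * int j + \<alpha>)
     + int_binom (- int i + 2 * int j + \<delta>) (2 * int j + \<alpha>) = - row_coeff e (i + b) (2 * j + p)" for i j
  proof -
    have nat: "2 * int j + \<alpha> = int (2 * j + p)" using assms by simp
    have "real_of_int (int i + 2 * int j + \<gamma>) = of_nat (2 * j + p) - of_int (e - int (i + b)) - 1"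
      "real_of_int (- int i + 2 * int j + \<delta>) = of_nat (2 * j + p) - of_int (e + int (i + b)) - 1"
      using assms by simp_all
    then have "int_binom (int i + 2 * int j + \<gamma>) (2 * int j + \<alpha>) = - (of_int (e - int (i + b)) gchoose (2 * j + p))"
      "int_binom (- int i + 2 * int j + \<delta>) (2 * int j + \<alpha>) = - (of_int (e + int (i + b)) gchoose (2 * j + p))"
      unfolding int_binom_def nat neg[of "of_int (e - int (i + b))"] neg[of "of_int (e + int (i + b))"]
      by (simp_all only: minus_minus of_nat_less_0_iff if_False nat_int)
    moreover have "4 powi (int i + \<beta>) = (4 ^ (i + b) :: real)"
      unfolding assms(3) of_nat_add[symmetric] by (rule power_int_of_nat)
    ultimately show ?thesis by (simp only: row_coeff_def minus_add_distrib mult_minus_right)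
  qed
  then show ?thesis unfolding F_def by simp
qed

text \<open>Enlarging size \<open>m\<close> multiplies by the ratio with index \<open>m + t\<close>,
  so the product has \<open>n + t\<close> factors; the value at \<open>n\<^sub>0\<close> fixes
  \<open>C\<close>.\<close>

lemma F_closed_form:
  fixes r s t n\<^sub>0 n :: nat and e :: int
  assumes params: "\<alpha> = 2 * int t + 1" "\<beta> = int r + int t" "\<gamma> = \<alpha> - e + \<beta> - 1" "\<delta> = \<alpha> - e - \<beta> - 1"
    and s: "s \<in> {1, 2, 3}" and e: "e = 3 * int r - int s"
    and large: "2 * r < n\<^sub>0 + t + s" "1 \<le> n\<^sub>0 + r + t"
    and filler: "\<And>v :: nat \<Rightarrow> real. \<exists>c. \<forall>j. (\<Sum>I<r + t. c I * row_coeff e I (2 * j + 1)) = (if j < t then v j else 0)"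
    and base: "F \<alpha> \<beta> \<gamma> \<delta> n\<^sub>0 = C * (\<Prod>k<n\<^sub>0 + t. step_ratio s k)"
    and n: "n\<^sub>0 \<le> n"
  shows "F \<alpha> \<beta> \<gamma> \<delta> n = C * (\<Prod>k<n + t. step_ratio s k)"
  using n
proof (induction n rule: dec_induct)
  case base
  show ?case by (rule assms(10))
next
  case (step m)
  have F: "F \<alpha> \<beta> \<gamma> \<delta> n = det (mat n n (\<lambda>(i, j). - row_coeff e (i + (r + t)) (2 * j + (2 * t + 1))))" for n
    using params by (intro F_eq_det) auto
  have "F \<alpha> \<beta> \<gamma> \<delta> (Suc m) = step_ratio s (m + t) * F \<alpha> \<beta> \<gamma> \<delta> m"
    unfolding F using large step.hyps by (intro det_extended_rows_step[OF s e _ _ filler]) auto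
  then show ?case using step.IH by simp
qed

section \<open>Tools for evaluating small determinants\<close>

lemma det_mat_Suc:
  fixes M :: "nat \<Rightarrow> nat \<Rightarrow> 'a::comm_ring_1"
  shows "det (mat (Suc n) (Suc n) (\<lambda>(i, j). M i j)) =
    (\<Sum>j<Suc n. (-1) ^ j * M 0 j * det (mat n n (\<lambda>(i, l). M (Suc i) (if l < j then l else Suc l))))"
proof -
  let ?A = "mat (Suc n) (Suc n) (\<lambda>(i, j). M i j)"
  have "mat_delete ?A 0 j = mat n n (\<lambda>(i, l). M (Suc i) (if l < j then l else Suc l))" if "j < Suc n" for j
    using that by (intro eq_matI) (auto simp: mat_delete_def)
  then show ?thesis
    using laplace_expansion_row[of ?A "Suc n" 0] by (simp add: cofactor_def mult_ac del: sum.lessThan_Suc)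
qed

lemma gbinomial_small:
  fixes x :: "'a::field_char_0"
  shows "x gchoose 3 = x * (x - 1) * (x - 2) / 6"
    and "x gchoose 5 = x * (x - 1) * (x - 2) * (x - 3) * (x - 4) / 120"
    and "x gchoose 7 = x * (x - 1) * (x - 2) * (x - 3) * (x - 4) * (x - 5) * (x - 6) / 5040"
  by (simp_all add: gbinomial_prod_rev eval_nat_numeral mult_ac)

section \<open>Initial values and Gamma functions\<close>

text \<open>One starting value for each family whose induction does not start at the empty
  determinant.\<close>

lemma F_base_values:
  "F 1 0 1 1 1 = 2" "F 1 0 2 2 1 = 4" "F 1 0 3 3 1 = 6"
  "F 1 1 0 (-2) 1 = -2" "F 1 1 1 (-1) 1 = 3" "F 3 2 2 (-2) 1 = -4"
  "F 1 1 (-1) (-3) 2 = 24" "F 1 2 (-1) (-5) 2 = 360"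
  "F 1 2 (-2) (-6) 3 = 24192" "F 1 2 (-3) (-7) 4 = 10450944" "F 1 3 (-3) (-9) 4 = 3990767616"
proof -
  have det1: "det (mat (Suc 0) (Suc 0) (\<lambda>(i, j). M i j)) = M 0 0" for M :: "nat \<Rightarrow> nat \<Rightarrow> real"
    using det_mat_Suc[of 0 M] by simp
  have det2: "det (mat 2 2 (\<lambda>(i, j). M i j)) = M 0 0 * M 1 1 - M 0 1 * M 1 0" for M :: "nat \<Rightarrow> nat \<Rightarrow> real"
    using det_mat_Suc[of 1 M] by (simp add: det1 numeral_2_eq_2)
  have det3: "det (mat 3 3 (\<lambda>(i, j). M i j)) =
      M 0 0 * (M 1 1 * M 2 2 - M 1 2 * M 2 1) - M 0 1 * (M 1 0 * M 2 2 - M 1 2 * M 2 0)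
      + M 0 2 * (M 1 0 * M 2 1 - M 1 1 * M 2 0)" for M :: "nat \<Rightarrow> nat \<Rightarrow> real"
    using det_mat_Suc[of 2 M] by (simp add: det2[unfolded numeral_2_eq_2] eval_nat_numeral)
  have det4: "det (mat 4 4 (\<lambda>(i, j). M i j)) =
      M 0 0 * det (mat 3 3 (\<lambda>(i, j). M (Suc i) (Suc j)))
      - M 0 1 * det (mat 3 3 (\<lambda>(i, j). M (Suc i) (if j < 1 then j else Suc j)))
      + M 0 2 * det (mat 3 3 (\<lambda>(i, j). M (Suc i) (if j < 2 then j else Suc j)))
      - M 0 3 * det (mat 3 3 (\<lambda>(i, j). M (Suc i) (if j < 3 then j else Suc j)))" for M :: "nat \<Rightarrow> nat \<Rightarrow> real"
    using det_mat_Suc[of 3 M] by (simp add: eval_nat_numeral)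
  have F: "F 1 (int b) (int b - e) (- e - int b) n = det (mat n n (\<lambda>(i, j). - row_coeff e (i + b) (2 * j + 1)))" for b e n
    by (rule F_eq_det) auto
  note entries = row_coeff_def gbinomial_small gbinomial_small(1)[unfolded numeral_3_eq_3]
  show "F 1 0 1 1 1 = 2" using F[of 0 "-1" 1] by (simp add: det1 entries)
  show "F 1 0 2 2 1 = 4" using F[of 0 "-2" 1] by (simp add: det1 entries)
  show "F 1 0 3 3 1 = 6" using F[of 0 "-3" 1] by (simp add: det1 entries)
  show "F 1 1 0 (-2) 1 = -2" using F[of 1 1 1] by (simp add: det1 entries)
  show "F 1 1 1 (-1) 1 = 3" using F[of 1 0 1] by (simp add: det1 entries)
  have "F 3 2 2 (-2) 1 = det (mat 1 1 (\<lambda>(i, j). - row_coeff 2 (i + 2) (2 * j + 3)))"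
    by (rule F_eq_det) auto
  then show "F 3 2 2 (-2) 1 = -4" by (simp add: det1 entries)
  show "F 1 1 (-1) (-3) 2 = 24" using F[of 1 2 2] by (simp add: det2 entries)
  show "F 1 2 (-1) (-5) 2 = 360" using F[of 2 3 2] by (simp add: det2 entries)
  show "F 1 2 (-2) (-6) 3 = 24192" using F[of 2 4 3] by (simp add: det3 entries)
  show "F 1 2 (-3) (-7) 4 = 10450944" using F[of 2 5 4] by (simp add: det4 det3 entries)
  show "F 1 3 (-3) (-9) 4 = 3990767616" using F[of 3 6 4] by (simp add: det4 det3 entries)
qed

section \<open>Gamma quotients as step ratios\<close>

lemma Gamma_plus1_real: "x > 0 \<Longrightarrow> Gamma (x + 1) = x * Gamma x" for x :: real
  by (intro Gamma_plus1) (auto elim!: nonpos_Ints_cases)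

lemma Gamma_half_shift: "y > 0 \<Longrightarrow> Gamma ((y + 2) / 2) = y / 2 * Gamma (y / 2)" for y :: real
  using Gamma_plus1_real[of "y / 2"] by (simp add: add_divide_distrib)

text \<open>Steps of two shift the arguments of the halved Gammas by the integers 1 and 3, so the
  quotient changes rationally; the factors \<open>(3 * x + 7) * (3 * x + 5)\<close> left in the
  numerator match the gap 1.\<close>

lemma step_ratio_1_Gamma:
  "3 ^ k * Gamma (3 * real (Suc k) - 1) * Gamma ((real (Suc k) + 1) / 2)
     / (Gamma (2 * real (Suc k)) * Gamma ((3 * real (Suc k) - 1) / 2)) = step_ratio 1 k"
proof -
  define T where "T k = 3 ^ k * fact (3 * k + 1) * Gamma ((real k + 2) / 2)
      / (fact (2 * k + 1) * Gamma ((3 * real k + 2) / 2))" for k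
  have "T k = step_ratio 1 k"
  proof (induction k rule: induct_nat_012)
    case 0
    show ?case by (simp add: T_def)
  next
    case 1
    have eq: "Gamma (5 / 2 :: real) = 3 / 2 * Gamma (3 / 2)" and nz: "Gamma (3 / 2 :: real) \<noteq> 0"
      using Gamma_plus1_real[of "3 / 2"] less_imp_neq[OF Gamma_real_pos[of "3 / 2"]] by simp_all
    from nz show ?case by (simp add: T_def eq fact_numeral)
  next
    case (ge2 k)
    define x where "x = real k"
    have x: "x \<ge> 0" by (simp add: x_def)
    define G H where "G = Gamma ((x + 2) / 2)" and "H = Gamma ((3 * x + 2) / 2)"
    have "H \<noteq> 0" using less_imp_neq[OF Gamma_real_pos[of "(3 * x + 2) / 2"]] x by (simp add: H_def)
    have "real (Suc (Suc k)) + 2 = x + 4" "3 * real (Suc (Suc k)) + 2 = 3 * x + 8"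
      by (simp_all add: x_def)
    moreover have "Gamma ((x + 4) / 2) = (x + 2) / 2 * G"
      using Gamma_half_shift[of "x + 2"] x by (simp add: G_def add_ac)
    moreover have "Gamma ((3 * x + 8) / 2) = 3 * (x + 2) / 2 * Gamma ((3 * x + 6) / 2)"
      "Gamma ((3 * x + 6) / 2) = (3 * x + 4) / 2 * Gamma ((3 * x + 4) / 2)"
      "Gamma ((3 * x + 4) / 2) = (3 * x + 2) / 2 * H"
      using Gamma_half_shift[of "3 * x + 6"] Gamma_half_shift[of "3 * x + 4"] Gamma_half_shift[of "3 * x + 2"] x
      by (simp_all add: H_def add_ac)
    moreover have "fact (3 * Suc (Suc k) + 1) =
        (3 * x + 7) * (3 * (x + 2)) * (3 * x + 5) * (3 * x + 4) * (3 * (x + 1)) * (3 * x + 2) * (fact (3 * k + 1) :: real)"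
    proof -
      have "3 * Suc (Suc k) + 1 = Suc (Suc (Suc (Suc (Suc (Suc (3 * k + 1))))))" by simp
      then show ?thesis by (simp only: fact_Suc) (simp add: x_def mult_ac add_ac)
    qed
    moreover have "fact (2 * Suc (Suc k) + 1) =
        2 * (x + 1) * (2 * x + 3) * (2 * (x + 2)) * (2 * x + 5) * (fact (2 * k + 1) :: real)"
    proof -
      have "2 * Suc (Suc k) + 1 = Suc (Suc (Suc (Suc (2 * k + 1))))" by simp
      then show ?thesis by (simp only: fact_Suc) (simp add: x_def mult_ac add_ac)
    qed
    moreover have "3 ^ Suc (Suc k) = 9 * (3 ^ k :: real)" by simp
    ultimately have "T (Suc (Suc k)) =
        9 * 3 ^ k * ((3 * x + 7) * (3 * (x + 2)) * (3 * x + 5) * (3 * x + 4) * (3 * (x + 1)) * (3 * x + 2) * fact (3 * k + 1))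
          * ((x + 2) / 2 * G)
        / (2 * (x + 1) * (2 * x + 3) * (2 * (x + 2)) * (2 * x + 5) * fact (2 * k + 1)
          * (3 * (x + 2) / 2 * ((3 * x + 4) / 2 * ((3 * x + 2) / 2 * H))))"
      by (simp only: T_def)
    also have "\<dots> = 27 * ((3 * x + 7) * (3 * x + 5)) / ((2 * x + 3) * (2 * x + 5))
        * (3 ^ k * fact (3 * k + 1) * G / (fact (2 * k + 1) * H))"
    proof -
      have cancel: "9 * w * (p7 * (3 * z) * p5 * p4 * (3 * y) * p2 * A) * (z / 2 * G)
            / (2 * y * a * (2 * z) * b * B * (3 * z / 2 * (p4 / 2 * (p2 / 2 * H))))
          = 27 * (p7 * p5) / (a * b) * (w * A * G / (B * H))"
        if "y \<noteq> 0" "z \<noteq> 0" "p2 \<noteq> 0" "p4 \<noteq> 0" "a \<noteq> 0" "b \<noteq> 0" "B \<noteq> 0" "H \<noteq> 0"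
        for w z y p2 p4 p5 p7 A a b B G H :: real
        using that by (simp add: field_simps)
      show ?thesis using x \<open>H \<noteq> 0\<close> by (intro cancel) auto
    qed
    also have "3 ^ k * fact (3 * k + 1) * G / (fact (2 * k + 1) * H) = T k"
      by (simp add: T_def G_def H_def x_def)
    also have "(3 * x + 7) * (3 * x + 5) = (3 * real k + 6)\<^sup>2 - real (node_gap 1) ^ 2"
      by (simp add: x_def node_gap_def power2_eq_square algebra_simps)
    finally show ?case by (simp add: ge2.IH x_def)
  qed
  moreover have "Gamma (3 * real (Suc k) - 1) = fact (3 * k + 1)" "Gamma (2 * real (Suc k)) = fact (2 * k + 1)"
    using Gamma_fact[of "3 * k + 1", where 'a = real] Gamma_fact[of "2 * k + 1", where 'a = real]
    by (simp_all add: algebra_simps)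
  moreover have "real (Suc k) + 1 = real k + 2" "3 * real (Suc k) - 1 = 3 * real k + 2" by simp_all
  ultimately show ?thesis by (simp only: T_def)
qed

text \<open>The same two-step comparison, now leaving \<open>(3 * x + 8) * (3 * x + 4)\<close>,
  which matches the gap 2.\<close>

lemma step_ratio_2_Gamma:
  "3 ^ k * Gamma (3 * real (Suc k)) * Gamma (real (Suc k) / 2)
     / (2 * Gamma (2 * real (Suc k)) * Gamma (3 * real (Suc k) / 2)) = step_ratio 2 k"
proof -
  define T where "T k = 3 ^ k * fact (3 * k + 2) * Gamma ((real k + 1) / 2)
      / (2 * fact (2 * k + 1) * Gamma ((3 * real k + 3) / 2))" for k
  have "T k = step_ratio 2 k"
  proof (induction k rule: induct_nat_012)
    case 0
    have eq: "Gamma (3 / 2 :: real) = 1 / 2 * Gamma (1 / 2)" and nz: "Gamma (1 / 2 :: real) \<noteq> 0"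
      using Gamma_plus1_real[of "1 / 2"] less_imp_neq[OF Gamma_real_pos[of "1 / 2"]] by simp_all
    from nz show ?case by (simp add: T_def eq)
  next
    case 1
    have "Gamma (3 :: real) = 2" using Gamma_fact[of 2, where 'a = real] by simp
    then show ?case by (simp add: T_def fact_numeral)
  next
    case (ge2 k)
    define x where "x = real k"
    have x: "x \<ge> 0" by (simp add: x_def)
    define G H where "G = Gamma ((x + 1) / 2)" and "H = Gamma ((3 * x + 3) / 2)"
    have "H \<noteq> 0" using less_imp_neq[OF Gamma_real_pos[of "(3 * x + 3) / 2"]] x by (simp add: H_def)
    have "real (Suc (Suc k)) + 1 = x + 3" "3 * real (Suc (Suc k)) + 3 = 3 * x + 9"
      by (simp_all add: x_def)
    moreover have "Gamma ((x + 3) / 2) = (x + 1) / 2 * G"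
      using Gamma_half_shift[of "x + 1"] x by (simp add: G_def add_ac)
    moreover have "Gamma ((3 * x + 9) / 2) = (3 * x + 7) / 2 * Gamma ((3 * x + 7) / 2)"
      "Gamma ((3 * x + 7) / 2) = (3 * x + 5) / 2 * Gamma ((3 * x + 5) / 2)"
      "Gamma ((3 * x + 5) / 2) = 3 * (x + 1) / 2 * H"
      using Gamma_half_shift[of "3 * x + 7"] Gamma_half_shift[of "3 * x + 5"] Gamma_half_shift[of "3 * x + 3"] x
      by (simp_all add: H_def add_ac)
    moreover have "fact (3 * Suc (Suc k) + 2) =
        (3 * x + 8) * (3 * x + 7) * (3 * (x + 2)) * (3 * x + 5) * (3 * x + 4) * (3 * (x + 1)) * (fact (3 * k + 2) :: real)"
    proof -
      have "3 * Suc (Suc k) + 2 = Suc (Suc (Suc (Suc (Suc (Suc (3 * k + 2))))))" by simp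
      then show ?thesis by (simp only: fact_Suc) (simp add: x_def mult_ac add_ac)
    qed
    moreover have "fact (2 * Suc (Suc k) + 1) =
        2 * (x + 1) * (2 * x + 3) * (2 * (x + 2)) * (2 * x + 5) * (fact (2 * k + 1) :: real)"
    proof -
      have "2 * Suc (Suc k) + 1 = Suc (Suc (Suc (Suc (2 * k + 1))))" by simp
      then show ?thesis by (simp only: fact_Suc) (simp add: x_def mult_ac add_ac)
    qed
    moreover have "3 ^ Suc (Suc k) = 9 * (3 ^ k :: real)" by simp
    ultimately have "T (Suc (Suc k)) =
        9 * 3 ^ k * ((3 * x + 8) * (3 * x + 7) * (3 * (x + 2)) * (3 * x + 5) * (3 * x + 4) * (3 * (x + 1)) * fact (3 * k + 2))
          * ((x + 1) / 2 * G)
        / (2 * (2 * (x + 1) * (2 * x + 3) * (2 * (x + 2)) * (2 * x + 5) * fact (2 * k + 1))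
          * ((3 * x + 7) / 2 * ((3 * x + 5) / 2 * (3 * (x + 1) / 2 * H))))"
      by (simp only: T_def)
    also have "\<dots> = 27 * ((3 * x + 8) * (3 * x + 4)) / ((2 * x + 3) * (2 * x + 5))
        * (3 ^ k * fact (3 * k + 2) * G / (2 * fact (2 * k + 1) * H))"
    proof -
      have cancel: "9 * w * (p8 * p7 * (3 * z) * p5 * p4 * (3 * y) * A) * (y / 2 * G)
            / (2 * (2 * y * a * (2 * z) * b * B) * (p7 / 2 * (p5 / 2 * (3 * y / 2 * H))))
          = 27 * (p8 * p4) / (a * b) * (w * A * G / (2 * B * H))"
        if "y \<noteq> 0" "z \<noteq> 0" "p5 \<noteq> 0" "p7 \<noteq> 0" "a \<noteq> 0" "b \<noteq> 0" "B \<noteq> 0" "H \<noteq> 0"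
        for w z y p4 p5 p7 p8 A a b B G H :: real
        using that by (simp add: field_simps)
      show ?thesis using x \<open>H \<noteq> 0\<close> by (intro cancel) auto
    qed
    also have "3 ^ k * fact (3 * k + 2) * G / (2 * fact (2 * k + 1) * H) = T k"
      by (simp add: T_def G_def H_def x_def)
    also have "(3 * x + 8) * (3 * x + 4) = (3 * real k + 6)\<^sup>2 - real (node_gap 2) ^ 2"
      by (simp add: x_def node_gap_def power2_eq_square algebra_simps)
    finally show ?case by (simp add: ge2.IH x_def)
  qed
  moreover have "Gamma (3 * real (Suc k)) = fact (3 * k + 2)" "Gamma (2 * real (Suc k)) = fact (2 * k + 1)"
    using Gamma_fact[of "3 * k + 2", where 'a = real] Gamma_fact[of "2 * k + 1", where 'a = real]
    by (simp_all add: algebra_simps)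
  moreover have "real (Suc k) = real k + 1" "3 * (real k + 1) = 3 * real k + 3" by simp_all
  ultimately show ?thesis by (simp only: T_def mult.assoc)
qed

text \<open>The residues 1 and 3 share the gap and hence the recursion; only the seeds differ. This
  accounts for \<open>3 ^ i\<close> instead of \<open>3 ^ (i - 1)\<close> in the third
  product.\<close>

lemma step_ratio_3: "step_ratio 3 k = 3 * step_ratio 1 k"
  by (induction k rule: induct_nat_012) (simp_all add: node_gap_def)

section \<open>Closed forms of all families\<close>

lemma F_closed_form_full:
  fixes r s n\<^sub>0 n :: nat
  assumes params: "\<beta> = int r" "\<gamma> = int s - 2 * int r" "\<delta> = int s - 4 * int r" and s: "s \<in> {1, 2, 3}"
    and large: "2 * r < n\<^sub>0 + s" "1 \<le> n\<^sub>0 + r"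
    and base: "F 1 \<beta> \<gamma> \<delta> n\<^sub>0 = C * (\<Prod>k<n\<^sub>0. step_ratio s k)"
    and n: "n\<^sub>0 \<le> n"
  shows "F 1 \<beta> \<gamma> \<delta> n = C * (\<Prod>k<n. step_ratio s k)"
proof -
  \<comment> \<open>With \<open>t = 0\<close> no column is missing, so the zero combination
    fills.\<close>
  have "\<exists>c. \<forall>j. (\<Sum>I<r + 0. c I * row_coeff e I (2 * j + 1)) = (if j < 0 then v j else 0)"
    for e and v :: "nat \<Rightarrow> real"
    by (intro exI[of _ "\<lambda>_. 0"]) simp
  then show ?thesis
    using F_closed_form[of 1 0 \<beta> r \<gamma> "3 * int r - int s" \<delta> s n\<^sub>0 C n] params s large base n by simp
qed

theorem theorem14:
  shows
  "(\<forall>n::nat. n \<ge> 1 \<longrightarrow>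
      F 1 0 1 1 n = 2 * (\<Prod>i=1..n. 3 ^ (i - 1) * Gamma (3 * real i - 1) * Gamma ((real i + 1) / 2)
                          / (Gamma (2 * real i) * Gamma ((3 * real i - 1) / 2)))
    \<and> F 1 0 2 2 n = 2 * (\<Prod>i=1..n. 3 ^ (i - 1) * Gamma (3 * real i) * Gamma (real i / 2)
                          / (2 * Gamma (2 * real i) * Gamma (3 * real i / 2)))
    \<and> F 1 0 3 3 n = 2 * (\<Prod>i=1..n. 3 ^ i * Gamma (3 * real i - 1) * Gamma ((real i + 1) / 2)
                          / (Gamma (2 * real i) * Gamma ((3 * real i - 1) / 2))))
  \<and> (\<forall>n::nat. n \<ge> 4 \<longrightarrow>
      (F 1 0 1 1 n = 2 / 3 * F 1 1 (-1) (-3) n \<and> F 1 0 1 1 n = 1 / 21 * F 1 2 (-3) (-7) n)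
    \<and> (F 1 0 2 2 n = - 2 * F 1 1 0 (-2) n \<and> F 1 0 2 2 n = 2 / 7 * F 1 2 (-2) (-6) n)
    \<and> (F 1 0 3 3 n = 2 * F 1 1 1 (-1) n \<and> F 1 0 3 3 n = 2 / 5 * F 1 2 (-1) (-5) n
        \<and> F 1 0 3 3 n = 1 / 99 * F 1 3 (-3) (-9) n)
    \<and> (F 1 1 (-1) (-3) n = - 6 * F 3 2 2 (-2) (n - 1)
        \<and> F 1 1 (-1) (-3) n = 24 * F 5 3 5 (-1) (n - 2))
    \<and> F 1 1 0 (-2) n = - 2 * F 3 2 3 (-1) (n - 1))"
proof -
  let ?P = "\<lambda>s n. \<Prod>k<n. step_ratio s k"
  have base: "?P s 1 = step_ratio s 0" "?P s 2 = step_ratio s 0 * step_ratio s 1"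
    "?P s 3 = step_ratio s 0 * step_ratio s 1 * step_ratio s 2"
    "?P s 4 = step_ratio s 0 * step_ratio s 1 * step_ratio s 2 * step_ratio s 3" for s
    by (simp_all add: eval_nat_numeral)
  have ratios: "step_ratio s 2 = 27 * (36 - real (node_gap s) ^ 2) / 15 * step_ratio s 0"
    "step_ratio s 3 = 27 * (81 - real (node_gap s) ^ 2) / 35 * step_ratio s 1" for s
    by (simp_all add: eval_nat_numeral)
  have vals: "?P 1 1 = 1" "?P 1 2 = 8" "?P 1 4 = 248832" "?P 2 1 = 2" "?P 2 3 = 3456"
    "?P 3 1 = 3" "?P 3 2 = 72" "?P 3 4 = 20155392"
    unfolding base ratios by (simp_all add: node_gap_def)
  note vals = vals F_base_values
  \<comment> \<open>The letters \<open>A\<close>, \<open>B\<close>, \<open>C\<close> stand for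
    \<open>s\<close> = 1, 2, 3 and the digit for \<open>r\<close>. Each leading constant is the
    starting value divided by the product of ratios at that size.\<close>
  have A0: "F 1 0 1 1 n = 2 * ?P 1 n" if "n \<ge> 1" for n
    by (rule F_closed_form_full[where r = 0 and n\<^sub>0 = 1]) (use that vals in simp_all)
  have B0: "F 1 0 2 2 n = 2 * ?P 2 n" if "n \<ge> 1" for n
    by (rule F_closed_form_full[where r = 0 and n\<^sub>0 = 1]) (use that vals in simp_all)
  have C0: "F 1 0 3 3 n = 2 * ?P 3 n" if "n \<ge> 1" for n
    by (rule F_closed_form_full[where r = 0 and n\<^sub>0 = 1]) (use that vals in simp_all)
  have A1: "F 1 1 (-1) (-3) n = 3 * ?P 1 n" if "n \<ge> 2" for n
    by (rule F_closed_form_full[where r = 1 and n\<^sub>0 = 2]) (use that vals in simp_all)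
  have A2: "F 1 2 (-3) (-7) n = 42 * ?P 1 n" if "n \<ge> 4" for n
    by (rule F_closed_form_full[where r = 2 and n\<^sub>0 = 4]) (use that vals in simp_all)
  have B1: "F 1 1 0 (-2) n = - 1 * ?P 2 n" if "n \<ge> 1" for n
    by (rule F_closed_form_full[where r = 1 and n\<^sub>0 = 1]) (use that vals in simp_all)
  have B2: "F 1 2 (-2) (-6) n = 7 * ?P 2 n" if "n \<ge> 3" for n
    by (rule F_closed_form_full[where r = 2 and n\<^sub>0 = 3]) (use that vals in simp_all)
  have C1: "F 1 1 1 (-1) n = 1 * ?P 3 n" if "n \<ge> 1" for n
    by (rule F_closed_form_full[where r = 1 and n\<^sub>0 = 1]) (use that vals in simp_all)
  have C2: "F 1 2 (-1) (-5) n = 5 * ?P 3 n" if "n \<ge> 2" for n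
    by (rule F_closed_form_full[where r = 2 and n\<^sub>0 = 2]) (use that vals in simp_all)
  have C3: "F 1 3 (-3) (-9) n = 198 * ?P 3 n" if "n \<ge> 4" for n
    by (rule F_closed_form_full[where r = 3 and n\<^sub>0 = 4]) (use that vals in simp_all)
  have vanish: "real m gchoose (2 * j + 1) = 0" if "m < 2 * j + 1" for m j
    using that by (simp flip: binomial_gbinomial add: binomial_eq_0)
  \<comment> \<open>This and the next two facts list the odd coefficients of
    \<open>2 (1 + x)^2\<close>, \<open>2 (1 + x)\<close> and
    \<open>4 (1 + x) + (1 + x)^3\<close>.\<close>
  have row20: "row_coeff 2 0 (2 * j + 1) = (if j = 0 then 4 else 0 :: real)" for j
    using vanish[of 2 j] by (cases j) (auto simp: row_coeff_def)
  have row10: "row_coeff 1 0 (2 * j + 1) = (if j = 0 then 2 else 0 :: real)" for j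
    using vanish[of 1 j] by (cases j) (auto simp: row_coeff_def)
  have row21: "row_coeff 2 1 (2 * j + 1) = (if j = 0 then 7 else if j = 1 then 1 else 0 :: real)" for j
  proof -
    consider "j = 0" | "j = 1" | "j \<ge> 2" by linarith
    then show ?thesis
      using vanish[of 1 j] vanish[of 3 j] by cases (auto simp: row_coeff_def gbinomial_small)
  qed
  have two: "{..<1 + 1} = {0, 1 :: nat}" and three: "{..<1 + 2} = {0, 1, 2 :: nat}" by auto
  have D1: "F 3 2 2 (-2) n = - 1 / 2 * ?P 1 (n + 1)" if "n \<ge> 1" for n
  proof (rule F_closed_form[where r = 1 and s = 1 and e = 2 and n\<^sub>0 = 1])
    show "\<exists>c. \<forall>j. (\<Sum>I<1 + 1. c I * row_coeff 2 I (2 * j + 1)) = (if j < 1 then v j else 0)" for v :: "nat \<Rightarrow> real"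
      unfolding two by (intro exI[of _ "\<lambda>I. if I = 0 then v 0 / 4 else 0"]) (simp add: row20[simplified])
  qed (use that vals in \<open>simp_all add: numeral_2_eq_2\<close>)
  \<comment> \<open>The empty determinant is 1, so the constant is the reciprocal of the product of
    the first two ratios, 1 and 8.\<close>
  have D2: "F 5 3 5 (-1) n = 1 / 8 * ?P 1 (n + 2)" for n
  proof (rule F_closed_form[where r = 1 and s = 1 and e = 2 and n\<^sub>0 = 0])
    show "\<exists>c. \<forall>j. (\<Sum>I<1 + 2. c I * row_coeff 2 I (2 * j + 1)) = (if j < 2 then v j else 0)" for v :: "nat \<Rightarrow> real"
      \<comment> \<open>Rows 0 and 1 have entries 4, 0 and 7, 1 in the two missing columns; the
        witness solves this triangular system.\<close>
      unfolding three by (intro exI[of _ "\<lambda>I. if I = 0 then (v 0 - 7 * v 1) / 4 else if I = 1 then v 1 else 0"])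
        (auto simp: row20[simplified] row21[simplified] less_2_cases_iff diff_divide_distrib)
  qed (use vals in \<open>simp_all add: F_def\<close>)
  \<comment> \<open>Again from the empty determinant: the constant is the reciprocal of
    \<open>step_ratio 2 0\<close>.\<close>
  have E1: "F 3 2 3 (-1) n = 1 / 2 * ?P 2 (n + 1)" for n
  proof (rule F_closed_form[where r = 1 and s = 2 and e = 1 and n\<^sub>0 = 0])
    show "\<exists>c. \<forall>j. (\<Sum>I<1 + 1. c I * row_coeff 1 I (2 * j + 1)) = (if j < 1 then v j else 0)" for v :: "nat \<Rightarrow> real"
      unfolding two by (intro exI[of _ "\<lambda>I. if I = 0 then v 0 / 2 else 0"]) (simp add: row10[simplified])
  qed (use vals in \<open>simp_all add: F_def\<close>)
  have P1: "?P 1 n = (\<Prod>i=1..n. 3 ^ (i - 1) * Gamma (3 * real i - 1) * Gamma ((real i + 1) / 2)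
                          / (Gamma (2 * real i) * Gamma ((3 * real i - 1) / 2)))" for n
    unfolding One_nat_def prod.atLeast1_atMost_eq diff_Suc_Suc diff_zero step_ratio_1_Gamma[unfolded One_nat_def] ..
  have P2: "?P 2 n = (\<Prod>i=1..n. 3 ^ (i - 1) * Gamma (3 * real i) * Gamma (real i / 2)
                          / (2 * Gamma (2 * real i) * Gamma (3 * real i / 2)))" for n
    unfolding One_nat_def prod.atLeast1_atMost_eq diff_Suc_Suc diff_zero step_ratio_2_Gamma ..
  have "step_ratio 3 k = 3 ^ Suc k * Gamma (3 * real (Suc k) - 1) * Gamma ((real (Suc k) + 1) / 2)
                          / (Gamma (2 * real (Suc k)) * Gamma ((3 * real (Suc k) - 1) / 2))" for k
    unfolding step_ratio_3 step_ratio_1_Gamma[symmetric] by simp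
  then have P3: "?P 3 n = (\<Prod>i=1..n. 3 ^ i * Gamma (3 * real i - 1) * Gamma ((real i + 1) / 2)
                          / (Gamma (2 * real i) * Gamma ((3 * real i - 1) / 2)))" for n
    unfolding One_nat_def prod.atLeast1_atMost_eq by simp
  show ?thesis
  proof (intro conjI allI impI)
    fix n :: nat assume n: "n \<ge> 4"
    \<comment> \<open>At the reduced sizes the products for \<alpha> = 3 and \<alpha> = 5 have
      \<open>n\<close> factors, as those for \<alpha> = 1 do at size \<open>n\<close>.\<close>
    have "n - 1 + 1 = n" "n - 2 + 2 = n"
      using n by simp_all
    note shifted = D1[of "n - 1", unfolded this] D2[of "n - 2", unfolded this] E1[of "n - 1", unfolded this]
    show "F 1 0 1 1 n = 2 / 3 * F 1 1 (-1) (-3) n" using A0 A1 n by simp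
    show "F 1 0 1 1 n = 1 / 21 * F 1 2 (-3) (-7) n" using A0 A2 n by simp
    show "F 1 0 2 2 n = - 2 * F 1 1 0 (-2) n" using B0 B1 n by simp
    show "F 1 0 2 2 n = 2 / 7 * F 1 2 (-2) (-6) n" using B0 B2 n by simp
    show "F 1 0 3 3 n = 2 * F 1 1 1 (-1) n" using C0 C1 n by simp
    show "F 1 0 3 3 n = 2 / 5 * F 1 2 (-1) (-5) n" using C0 C2 n by simp
    show "F 1 0 3 3 n = 1 / 99 * F 1 3 (-3) (-9) n" using C0 C3 n by simp
    show "F 1 1 (-1) (-3) n = - 6 * F 3 2 2 (-2) (n - 1)" using A1 shifted n by simp
    show "F 1 1 (-1) (-3) n = 24 * F 5 3 5 (-1) (n - 2)" using A1 shifted n by simp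
    show "F 1 1 0 (-2) n = - 2 * F 3 2 3 (-1) (n - 1)" using B1 shifted n by simp
  qed (use A0 B0 C0 in \<open>simp_all only: P1 P2 P3\<close>)
qed

end
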